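(* Let $A$ be an operator algebra which is a hereditary subalgebra (HSA) in its bidual $A^{**}$; that is, $A$ has a contractive approximate identity and $A A^{**} A \subset A$. Then $A$ is nc-discrete; that is, every right ideal of $A$ which has a left contractive approximate identity is of the form $eA$ for a projection $e \in M(A)$.
   Context: An operator algebra is a norm closed algebra of operators on a complex Hilbert space. The bidual $A^{**}$ is an operator algebra with its (unique) Arens product, and $A$ is viewed as a subalgebra of $A^{**}$ in the canonical way. A contractive approximate identity (cai) is a two-sided approximate identity of norm at most $1$; a left cai for a right ideal $J$ is a net $(e_t)$ in the unit ball of $J$ with $e_t x \to x$ for all $x \in J$. When $A$ has a cai, $A^{**}$ has an identity of norm $1$, and the multiplier algebra is $M(A) = \{\alpha \in A^{**} : \alpha A \subset A,\ A\alpha \subset A\}$. Projections are always orthogonal projections (equivalently, contractive idempotents of $A^{**}$). Right ideals are norm closed. A subalgebra $D$ of an operator algebra $B$ is a hereditary subalgebra (HSA) in $B$ if $D$ is norm closed, has a cai, and $DBD \subset D$. An operator algebra with cai is called nc-discrete if every right ideal having a left cai is of the form $eA$ for a projection $e \in M(A)$; equivalently, every open projection in $A^{**}$ (a projection $p\in A^{**}$ for which there is a net $x_t\in A$ with $x_t = p x_t p \to p$ weak* ) lies in $M(A)$. *)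

theory Defs
  imports "HOL-Analysis.Analysis" "HOL-Library.Function_Algebras"
begin

section \<open>Complex Hilbert spaces and operator algebras\<close>

class complex_hilbert = banach +
  fixes scaleC :: "complex \<Rightarrow> 'a \<Rightarrow> 'a"  (infixr "*\<^sub>C" 75)
    and cinner :: "'a \<Rightarrow> 'a \<Rightarrow> complex"
  assumes scaleC_add_right: "c *\<^sub>C (x + y) = c *\<^sub>C x + c *\<^sub>C y"
    and scaleC_add_left: "(c + d) *\<^sub>C x = c *\<^sub>C x + d *\<^sub>C x"
    and scaleC_scaleC: "c *\<^sub>C d *\<^sub>C x = (c * d) *\<^sub>C x"
    and scaleC_one: "1 *\<^sub>C x = x"
    and scaleR_scaleC: "r *\<^sub>R x = complex_of_real r *\<^sub>C x"
    and cinner_commute: "cinner x y = cnj (cinner y x)"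
    and cinner_add_left: "cinner (x + y) z = cinner x z + cinner y z"
    and cinner_scaleC_left: "cinner (c *\<^sub>C x) y = c * cinner x y"
    and cinner_ge_zero: "0 \<le> Re (cinner x x)"
    and cinner_eq_zero_iff: "cinner x x = 0 \<longleftrightarrow> x = 0"
    and norm_eq_sqrt_cinner: "norm x = sqrt (Re (cinner x x))"

instantiation complex :: complex_hilbert
begin
definition scaleC_complex :: "complex \<Rightarrow> complex \<Rightarrow> complex" where
  "scaleC_complex c x = c * x"
definition cinner_complex :: "complex \<Rightarrow> complex \<Rightarrow> complex" where
  "cinner_complex x y = x * cnj y"
instance
proof
  fix x :: complex
  show "norm x = sqrt (Re (cinner x x))"
    by (simp add: cinner_complex_def cmod_def power2_eq_square)
qed (auto simp: scaleC_complex_def cinner_complex_def algebra_simps scaleR_conv_of_real)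
end

lemma norm_scaleC: "norm (c *\<^sub>C x) = cmod c * norm (x :: 'h::complex_hilbert)"
proof -
  have "cinner (c *\<^sub>C x) (c *\<^sub>C x) = c * cnj c * cinner x x"
    using cinner_commute[of x "c *\<^sub>C x"] cinner_commute[of x x]
    by (simp add: cinner_scaleC_left)
  also have "\<dots> = complex_of_real ((cmod c)\<^sup>2) * cinner x x"
    by (simp only: complex_norm_square)
  finally have "Re (cinner (c *\<^sub>C x) (c *\<^sub>C x)) = (cmod c)\<^sup>2 * Re (cinner x x)"
    by simp
  then show ?thesis
    by (simp add: norm_eq_sqrt_cinner[of x] norm_eq_sqrt_cinner[of "c *\<^sub>C x"] real_sqrt_mult)
qed

lemma bounded_linear_scaleC: "bounded_linear (\<lambda>x :: 'h::complex_hilbert. c *\<^sub>C x)"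
  by (rule bounded_linear_intro[where K = "cmod c"])
     (simp_all add: scaleC_add_right scaleR_scaleC scaleC_scaleC norm_scaleC mult.commute)

lift_definition scaleC_op ::
    "complex \<Rightarrow> ('h::complex_hilbert \<Rightarrow>\<^sub>L 'h) \<Rightarrow> ('h \<Rightarrow>\<^sub>L 'h)"
  is "\<lambda>c T x. c *\<^sub>C T x"
  by (rule bounded_linear_compose[OF bounded_linear_scaleC])

text \<open>
  The type \<open>'h \<Rightarrow>\<^sub>L 'h\<close> consists of the bounded real-linear maps, so complex homogeneity is
  required separately.  The real and the complex operator norm of such a map agree.
\<close>

definition operator_algebra :: "('h::complex_hilbert \<Rightarrow>\<^sub>L 'h) set \<Rightarrow> bool" where
  "operator_algebra A \<longleftrightarrow>
     (\<forall>T\<in>A. \<forall>c x. T (c *\<^sub>C x) = c *\<^sub>C T x) \<and>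
     0 \<in> A \<and>
     (\<forall>S\<in>A. \<forall>T\<in>A. S + T \<in> A) \<and>
     (\<forall>c. \<forall>T\<in>A. scaleC_op c T \<in> A) \<and>
     (\<forall>S\<in>A. \<forall>T\<in>A. S o\<^sub>L T \<in> A) \<and>
     closed A"

definition right_ideal ::
    "('h::complex_hilbert \<Rightarrow>\<^sub>L 'h) set \<Rightarrow> ('h \<Rightarrow>\<^sub>L 'h) set \<Rightarrow> bool" where
  "right_ideal A J \<longleftrightarrow>
     J \<subseteq> A \<and>
     0 \<in> J \<and>
     (\<forall>x\<in>J. \<forall>y\<in>J. x + y \<in> J) \<and>
     (\<forall>c. \<forall>x\<in>J. scaleC_op c x \<in> J) \<and>
     (\<forall>x\<in>J. \<forall>a\<in>A. x o\<^sub>L a \<in> J) \<and>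
     closed J"

text \<open>
  Nets are rendered as proper filters on the algebra: a net gives the filter generated by
  its tails, and every proper filter arises from a net in this way.
\<close>

definition has_cai :: "('h::complex_hilbert \<Rightarrow>\<^sub>L 'h) set \<Rightarrow> bool" where
  "has_cai A \<longleftrightarrow>
     (\<exists>F. F \<noteq> bot \<and>
          (\<forall>\<^sub>F e in F. e \<in> A \<and> norm e \<le> 1) \<and>
          (\<forall>x\<in>A. ((\<lambda>e. e o\<^sub>L x) \<longlongrightarrow> x) F \<and> ((\<lambda>e. x o\<^sub>L e) \<longlongrightarrow> x) F))"

definition has_left_cai :: "('h::complex_hilbert \<Rightarrow>\<^sub>L 'h) set \<Rightarrow> bool" where
  "has_left_cai J \<longleftrightarrow>
     (\<exists>F. F \<noteq> bot \<and>
          (\<forall>\<^sub>F e in F. e \<in> J \<and> norm e \<le> 1) \<and>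
          (\<forall>x\<in>J. ((\<lambda>e. e o\<^sub>L x) \<longlongrightarrow> x) F))"

section \<open>The bidual with its Arens product\<close>

text \<open>
  The dual of a complex normed space with carrier \<open>V\<close>, scalar multiplication \<open>s\<close> and norm
  \<open>n\<close>.  Functionals are set to \<open>0\<close> outside \<open>V\<close>, so that equality of functionals is equality
  on \<open>V\<close>.
\<close>

definition cdual ::
    "(complex \<Rightarrow> 'v \<Rightarrow> 'v) \<Rightarrow> ('v \<Rightarrow> real) \<Rightarrow> ('v::ab_group_add) set \<Rightarrow> ('v \<Rightarrow> complex) set" where
  "cdual s n V =
     {f. (\<forall>x\<in>V. \<forall>y\<in>V. f (x + y) = f x + f y) \<and>
         (\<forall>c. \<forall>x\<in>V. f (s c x) = c * f x) \<and>
         (\<exists>K. \<forall>x\<in>V. cmod (f x) \<le> K * n x) \<and>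
         (\<forall>x. x \<notin> V \<longrightarrow> f x = 0)}"

definition cdual_norm :: "('v \<Rightarrow> real) \<Rightarrow> 'v set \<Rightarrow> ('v \<Rightarrow> complex) \<Rightarrow> real" where
  "cdual_norm n V f = (SUP x\<in>{x\<in>V. n x \<le> 1}. cmod (f x))"

type_synonym 'h dual_elem = "('h \<Rightarrow>\<^sub>L 'h) \<Rightarrow> complex"
type_synonym 'h bidual_elem = "'h dual_elem \<Rightarrow> complex"

definition dual :: "('h::complex_hilbert \<Rightarrow>\<^sub>L 'h) set \<Rightarrow> 'h dual_elem set" where
  "dual A = cdual scaleC_op norm A"

definition dual_norm :: "('h::complex_hilbert \<Rightarrow>\<^sub>L 'h) set \<Rightarrow> 'h dual_elem \<Rightarrow> real" where
  "dual_norm A = cdual_norm norm A"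

definition bidual :: "('h::complex_hilbert \<Rightarrow>\<^sub>L 'h) set \<Rightarrow> 'h bidual_elem set" where
  "bidual A = cdual (\<lambda>c f x. c * f x) (dual_norm A) (dual A)"

definition bidual_norm :: "('h::complex_hilbert \<Rightarrow>\<^sub>L 'h) set \<Rightarrow> 'h bidual_elem \<Rightarrow> real" where
  "bidual_norm A = cdual_norm (dual_norm A) (dual A)"

definition canon ::
    "('h::complex_hilbert \<Rightarrow>\<^sub>L 'h) set \<Rightarrow> ('h \<Rightarrow>\<^sub>L 'h) \<Rightarrow> 'h bidual_elem" where
  "canon A a = (\<lambda>f. if f \<in> dual A then f a else 0)"

text \<open>
  The first Arens product: \<open>(f \<cdot> a)(b) = f (a b)\<close>, \<open>(\<psi> \<cdot> f)(a) = \<psi> (f \<cdot> a)\<close> and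
  \<open>(\<phi> \<psi>)(f) = \<phi> (\<psi> \<cdot> f)\<close>.  Operator algebras are Arens regular, so the second Arens product
  is the same.
\<close>

definition dual_act_alg ::
    "('h::complex_hilbert \<Rightarrow>\<^sub>L 'h) set \<Rightarrow> 'h dual_elem \<Rightarrow> ('h \<Rightarrow>\<^sub>L 'h) \<Rightarrow> 'h dual_elem" where
  "dual_act_alg A f a = (\<lambda>b. if b \<in> A then f (a o\<^sub>L b) else 0)"

definition bidual_act_dual ::
    "('h::complex_hilbert \<Rightarrow>\<^sub>L 'h) set \<Rightarrow> 'h bidual_elem \<Rightarrow> 'h dual_elem \<Rightarrow> 'h dual_elem" where
  "bidual_act_dual A \<psi> f = (\<lambda>a. if a \<in> A then \<psi> (dual_act_alg A f a) else 0)"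

definition arens ::
    "('h::complex_hilbert \<Rightarrow>\<^sub>L 'h) set \<Rightarrow> 'h bidual_elem \<Rightarrow> 'h bidual_elem \<Rightarrow> 'h bidual_elem" where
  "arens A \<phi> \<psi> = (\<lambda>f. if f \<in> dual A then \<phi> (bidual_act_dual A \<psi> f) else 0)"

section \<open>Multipliers, projections, hereditary subalgebras, nc-discreteness\<close>

definition multiplier_algebra ::
    "('h::complex_hilbert \<Rightarrow>\<^sub>L 'h) set \<Rightarrow> 'h bidual_elem set" where
  "multiplier_algebra A =
     {\<alpha> \<in> bidual A. \<forall>a\<in>A. arens A \<alpha> (canon A a) \<in> canon A ` A \<and>
                          arens A (canon A a) \<alpha> \<in> canon A ` A}"

text \<open>
  The orthogonal projections in \<open>A\<^sup>*\<^sup>*\<close> are its contractive idempotents; this form does not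
  depend on how \<open>A\<^sup>*\<^sup>*\<close> is represented on a Hilbert space.
\<close>

definition bidual_projection ::
    "('h::complex_hilbert \<Rightarrow>\<^sub>L 'h) set \<Rightarrow> 'h bidual_elem \<Rightarrow> bool" where
  "bidual_projection A e \<longleftrightarrow> e \<in> bidual A \<and> arens A e e = e \<and> bidual_norm A e \<le> 1"

text \<open>
  No closedness condition is needed: \<open>canon A\<close> is an isometry and \<open>A\<close> is complete, so the
  copy of \<open>A\<close> in \<open>A\<^sup>*\<^sup>*\<close> is always norm closed.
\<close>

definition hereditary_in_bidual :: "('h::complex_hilbert \<Rightarrow>\<^sub>L 'h) set \<Rightarrow> bool" where
  "hereditary_in_bidual A \<longleftrightarrow>
     has_cai A \<and>
     (\<forall>a\<in>A. \<forall>\<phi>\<in>bidual A. \<forall>b\<in>A.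
        arens A (arens A (canon A a) \<phi>) (canon A b) \<in> canon A ` A)"

definition nc_discrete :: "('h::complex_hilbert \<Rightarrow>\<^sub>L 'h) set \<Rightarrow> bool" where
  "nc_discrete A \<longleftrightarrow>
     operator_algebra A \<and> has_cai A \<and>
     (\<forall>J. right_ideal A J \<and> has_left_cai J \<longrightarrow>
        (\<exists>e\<in>multiplier_algebra A. bidual_projection A e \<and>
            canon A ` J = (\<lambda>a. arens A e (canon A a)) ` A))"

end

theory Submission
  imports Defs
begin

text \<open>
  Let \<open>J\<close> be a right ideal with a left cai and \<open>p \<in> A\<^sup>*\<^sup>*\<close> a weak* limit of it.  Since
  \<open>c p b \<in> A\<close> for \<open>c, b \<in> A\<close>, Mazur's theorem yields contractions \<open>x \<in> J\<close> with \<open>c x b\<close> close in norm to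
  \<open>c p b\<close>; as \<open>c\<close> may be taken from the cai of \<open>A\<close>, a contraction that almost fixes \<open>b\<close> on both sides,
  the forms \<open>\<xi> \<mapsto> \<langle>x b \<xi>, b \<xi>\<rangle>\<close> are then uniformly close to \<open>\<langle>p b \<xi>, b \<xi>\<rangle>\<close>.  Averaging
  such \<open>x\<close>, each of which almost fixes the preceding ones, gives \<open>\<parallel>x b \<xi>\<parallel>\<^sup>2\<close> the same uniform
  limit, whence \<open>x b\<close> is norm Cauchy and \<open>p b \<in> J\<close>.  So \<open>p\<close> acts on \<open>A\<close> from the left as the
  orthogonal projection \<open>P\<close> onto the closed span of the ranges of \<open>J\<close>; self-adjointness of \<open>P\<close> then gives
  \<open>A P \<subseteq> A\<close>.
\<close>

section \<open>Linear functionals below sublinear ones\<close>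

text \<open>The obstacle: heredity speaks of sandwiches \<open>c p b\<close>, the claim of
  \<open>p b\<close>, and a left factor \<open>c\<close> cannot be cancelled in norm. With v = b
  \<xi> it can be cancelled in the form <c x v, v>, because a contraction that almost fixes v has an
  adjoint that does so too. The price is that only a quadratic form is controlled, not the operator
  \<open>x b\<close>. A projection has norm (p v) ^ 2 = <p v, v> for free; for elements of
  \<open>J\<close> this has to be enforced, and averaging does it because the mixed terms outnumber
  the diagonal ones. For two such units z, x with z x near x, the expansion of norm (z v - x v) ^ 2
  is then close to h - 2 h + h. From there on the abstract limit is dropped. \<open>P\<close> lives
  on the given Hilbert space, and the projection in the bidual is rebuilt from the two maps b -> P b
  and a -> a P, so that the bidual need not be represented on a Hilbert space. Throughout, closeness
  of order s^2 in norm costs an error of order s in the forms.\<close>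

definition sublinear :: "('a::real_vector \<Rightarrow> real) \<Rightarrow> bool" where
  "sublinear q \<longleftrightarrow>
     (\<forall>x y. q (x + y) \<le> q x + q y) \<and> (\<forall>t x. 0 \<le> t \<longrightarrow> q (t *\<^sub>R x) = t * q x)"

text \<open>The inequality at \<open>inverse t\<close> reverses the one at \<open>t\<close>, so one
  direction of positive homogeneity is enough.\<close>

lemma sublinearI:
  assumes "\<And>x y. q (x + y) \<le> q x + q y" and "\<And>t x. 0 < t \<Longrightarrow> q (t *\<^sub>R x) \<le> t * q x"
    and "q 0 = 0"
  shows "sublinear q"
proof -
  have "q (t *\<^sub>R x) = t * q x" if "0 \<le> t" for t x
  proof (cases "t = 0")
    case False
    then have t: "0 < t" using that by simp
    have "q (inverse t *\<^sub>R t *\<^sub>R x) \<le> inverse t * q (t *\<^sub>R x)"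
      using t by (intro assms(2)) auto
    then have "t * q x \<le> q (t *\<^sub>R x)"
      using t by (simp add: field_simps)
    then show ?thesis using assms(2)[OF t, of x] by simp
  qed (simp add: assms(3))
  then show ?thesis unfolding sublinear_def using assms(1) by blast
qed

lemma sublinear_zero: "sublinear q \<Longrightarrow> q 0 = 0"
  unfolding sublinear_def by (metis mult_zero_left order_refl scaleR_zero_left)

lemma sublinear_minus: "sublinear q \<Longrightarrow> - q (- x) \<le> q x"
  using sublinear_zero[of q] unfolding sublinear_def
  by (metis add.right_inverse add_le_cancel_right add.commute neg_0_le_iff_le add_uminus_conv_diff
      diff_0 diff_le_eq)

text \<open>Zorn's lemma for the reversed pointwise order. The infimum of a chain is finite because
  its members lie above x \<mapsto> -p (-x), and subadditive because the smaller of two members may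
  take the place of both.\<close>

lemma exists_minimal_sublinear:
  fixes p :: "'a::real_vector \<Rightarrow> real"
  assumes p: "sublinear p"
  obtains q where "sublinear q" "q \<le> p" "\<And>r. sublinear r \<Longrightarrow> r \<le> q \<Longrightarrow> r = q"
proof -
  define S where "S = {q. sublinear q \<and> q \<le> p}"
  have "\<exists>m\<in>S. \<forall>a\<in>S. a \<le> m \<longrightarrow> a = m"
  proof (rule predicate_Zorn)
    show "partial_order_on S (relation_of (\<lambda>x y. y \<le> x) S)"
      by (rule partial_order_on_relation_ofI) auto
    fix C assume C: "C \<in> Chains (relation_of (\<lambda>x y. y \<le> x) S)"
    show "\<exists>u\<in>S. \<forall>a\<in>C. u \<le> a"
    proof (cases "C = {}")
      case True
      then show ?thesis using p by (auto simp: S_def)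
    next
      case False
      have CS: "\<And>q. q \<in> C \<Longrightarrow> q \<in> S" and
        tot: "\<And>q r. q \<in> C \<Longrightarrow> r \<in> C \<Longrightarrow> q \<le> r \<or> r \<le> q"
        using C by (auto simp: Chains_def relation_of_def)
      define u where "u x = (INF q\<in>C. q x)" for x
      have bdd: "bdd_below ((\<lambda>q. q x) ` C)" for x
      proof (rule bdd_belowI2)
        fix q assume "q \<in> C"
        then have "sublinear q" "q (- x) \<le> p (- x)" using CS by (auto simp: S_def le_fun_def)
        then show "- p (- x) \<le> q x" using sublinear_minus[of q x] by simp
      qed
      have lower: "u x \<le> q x" if "q \<in> C" for q x
        unfolding u_def using that bdd by (intro cINF_lower) auto
      have "sublinear u"
      proof (rule sublinearI)
        fix x y
        have "u (x + y) - r y \<le> q x" if qr: "q \<in> C" "r \<in> C" for q r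
        proof -
          obtain s where s: "s \<in> C" "s \<le> q" "s \<le> r" using tot[OF qr] qr by blast
          have "u (x + y) \<le> s (x + y)" by (rule lower[OF s(1)])
          also have "\<dots> \<le> s x + s y"
            using CS[OF s(1)] by (auto simp: S_def sublinear_def)
          also have "\<dots> \<le> q x + r y" using s by (intro add_mono) (auto simp: le_fun_def)
          finally show ?thesis by simp
        qed
        then have "u (x + y) - r y \<le> u x" if "r \<in> C" for r
          unfolding u_def[of x] using that by (intro cINF_greatest False) auto
        then have "u (x + y) - u x \<le> r y" if "r \<in> C" for r
          using that by (fastforce simp: algebra_simps)
        then have "u (x + y) - u x \<le> u y"
          unfolding u_def[of y] by (intro cINF_greatest False) auto
        then show "u (x + y) \<le> u x + u y" by simp
      next
        fix t :: real and x assume t: "0 < t"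
        have "u (t *\<^sub>R x) / t \<le> q x" if "q \<in> C" for q
        proof -
          have "u (t *\<^sub>R x) \<le> t * q x"
            using lower[OF that, of "t *\<^sub>R x"] CS[OF that] t by (auto simp: S_def sublinear_def)
          then show ?thesis using t by (simp add: field_simps)
        qed
        then have "u (t *\<^sub>R x) / t \<le> u x"
          unfolding u_def[of x] by (intro cINF_greatest False) auto
        then show "u (t *\<^sub>R x) \<le> t * u x" using t by (simp add: field_simps)
      next
        have "(\<lambda>q. q 0) ` C = {0}"
          using CS False by (auto simp: S_def sublinear_zero image_def)
        then show "u 0 = 0" by (simp add: u_def)
      qed
      moreover obtain q where q: "q \<in> C" using False by auto
      have "u \<le> p"
        using lower[OF q] CS[OF q] by (auto simp: S_def le_fun_def intro: order_trans)
      ultimately show ?thesis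
        using lower by (auto simp: S_def le_fun_def intro!: bexI[of _ u])
    qed
  qed
  then obtain q where q: "q \<in> S" "\<And>a. a \<in> S \<Longrightarrow> a \<le> q \<Longrightarrow> a = q" by blast
  show ?thesis
  proof (rule that)
    show "sublinear q" "q \<le> p" using q(1) by (auto simp: S_def)
    show "r = q" if "sublinear r" "r \<le> q" for r
      using that q by (auto simp: S_def intro: order_trans)
  qed
qed

text \<open>A minimal sublinear functional \<open>q\<close> is linear, because
  \<open>x \<mapsto> inf\<^sub>t\<^sub>\<ge>\<^sub>0 (q (x + t y) - t q y)\<close> is a sublinear minorant of it for every \<open>y\<close>.\<close>

theorem sublinear_dominates_linear:
  fixes p :: "'a::real_vector \<Rightarrow> real"
  assumes p: "sublinear p"
  obtains f where "linear f" "\<And>x. f x \<le> p x"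
proof -
  obtain q where q: "sublinear q" "q \<le> p" and min: "\<And>r. sublinear r \<Longrightarrow> r \<le> q \<Longrightarrow> r = q"
    using exists_minimal_sublinear[OF p] by blast
  have sub: "q (x + y) \<le> q x + q y" and hom: "0 \<le> t \<Longrightarrow> q (t *\<^sub>R x) = t * q x" for x y t
    using q(1) by (auto simp: sublinear_def)
  have super: "q x + q y \<le> q (x + y)" for x y
  proof -
    define r where "r x = (INF t\<in>{0..}. q (x + t *\<^sub>R y) - t * q y)" for x
    have bdd: "bdd_below ((\<lambda>t. q (x + t *\<^sub>R y) - t * q y) ` {0..})" for x
    proof (rule bdd_belowI2)
      fix t :: real assume "t \<in> {0..}"
      then show "- q (- x) \<le> q (x + t *\<^sub>R y) - t * q y"
        using sub[of "x + t *\<^sub>R y" "- x"] hom[of t y] by simp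
    qed
    have lower: "r x \<le> q (x + t *\<^sub>R y) - t * q y" if "0 \<le> t" for t x
      unfolding r_def using that bdd by (intro cINF_lower) auto
    have "sublinear r"
    proof (rule sublinearI)
      fix x x'
      have *: "r (x + x') \<le> (q (x + t *\<^sub>R y) - t * q y) + (q (x' + t' *\<^sub>R y) - t' * q y)"
        if "0 \<le> t" "0 \<le> t'" for t t'
        using lower[of "t + t'" "x + x'"] sub[of "x + t *\<^sub>R y" "x' + t' *\<^sub>R y"] that
        by (simp add: algebra_simps)
      have "r (x + x') - (q (x' + t' *\<^sub>R y) - t' * q y) \<le> r x" if "0 \<le> t'" for t'
        unfolding r_def[of x]
      proof (rule cINF_greatest)
        fix t :: real assume "t \<in> {0..}"
        then show "r (x + x') - (q (x' + t' *\<^sub>R y) - t' * q y) \<le> q (x + t *\<^sub>R y) - t * q y"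
          using *[of t t'] that by simp
      qed auto
      then have "r (x + x') - r x \<le> r x'"
        unfolding r_def[of x'] by (intro cINF_greatest) (auto simp: algebra_simps)
      then show "r (x + x') \<le> r x + r x'" by simp
    next
      fix s :: real and x assume s: "0 < s"
      have "r (s *\<^sub>R x) / s \<le> q (x + t *\<^sub>R y) - t * q y" if "0 \<le> t" for t
      proof -
        have "r (s *\<^sub>R x) \<le> q (s *\<^sub>R (x + t *\<^sub>R y)) - (s * t) * q y"
          using lower[of "s * t" "s *\<^sub>R x"] s that by (simp add: algebra_simps)
        also have "\<dots> = s * (q (x + t *\<^sub>R y) - t * q y)"
          using s by (subst hom) (auto simp: algebra_simps)
        finally show ?thesis using s by (simp add: field_simps)
      qed
      then have "r (s *\<^sub>R x) / s \<le> r x"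
        unfolding r_def[of x] by (intro cINF_greatest) auto
      then show "r (s *\<^sub>R x) \<le> s * r x" using s by (simp add: field_simps)
    next
      have "(\<lambda>t. q (0 + t *\<^sub>R y) - t * q y) ` {0..} = {0}"
        using hom by (auto simp: image_def)
      then show "r 0 = 0" by (simp add: r_def)
    qed
    moreover have "r \<le> q" using lower[of 0] by (auto simp: le_fun_def)
    ultimately have "r = q" by (rule min)
    \<comment> \<open>Once \<open>r = q\<close>, the competitor \<open>t = 1\<close> in the infimum
      reads \<open>q x \<le> q (x + y) - q y\<close>.\<close>
    then show ?thesis using lower[of 1 x] by simp
  qed
  have add: "q (x + y) = q x + q y" for x y using sub super by (simp add: antisym)
  have neg: "q (- x) = - q x" for x
    using add[of x "- x"] sublinear_zero[OF q(1)] by simp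
  have "linear q"
  proof (rule linearI)
    fix t :: real and x
    show "q (t *\<^sub>R x) = t *\<^sub>R q x"
      using hom[of t x] hom[of "- t" x] neg[of "t *\<^sub>R x"] by (cases "0 \<le> t") auto
  qed (rule add)
  then show ?thesis using that q(2) by (auto simp: le_fun_def)
qed

text \<open>The functional is found below \<open>p\<close>, the infimum over t \<ge> 0 and s in
  \<open>S\<close> of norm (x + t s) - t \<delta>. The distance assumption keeps \<open>p\<close>
  above -norm x; convexity merges t s + t' s' into (t + t') w and makes it subadditive. The
  competitor t = 0 gives f \<le> norm, and t = 1 at x = -s gives f (-s) \<le> -\<delta>.\<close>

theorem convex_separation_from_zero:
  fixes S :: "'a::real_normed_vector set"
  assumes "convex S" "S \<noteq> {}" and far: "\<And>s. s \<in> S \<Longrightarrow> \<delta> \<le> norm s"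
  obtains f where "linear f" "\<And>x. \<bar>f x\<bar> \<le> norm x" "\<And>s. s \<in> S \<Longrightarrow> \<delta> \<le> f s"
proof -
  define I where "I = ({0..} :: real set) \<times> S"
  define N where "N x i = norm (x + fst i *\<^sub>R snd i) - fst i * \<delta>" for x :: 'a and i :: "real \<times> 'a"
  define p where "p x = (INF i\<in>I. N x i)" for x
  obtain s0 where s0: "s0 \<in> S" using assms by auto
  then have ne: "I \<noteq> {}" by (auto simp: I_def)
  have lb: "- norm x \<le> N x i" if iI: "i \<in> I" for x i
  proof -
    obtain t s where i: "i = (t, s)" "0 \<le> t" "s \<in> S" using iI by (auto simp: I_def)
    have "t * \<delta> \<le> norm (t *\<^sub>R s)" using i far[of s] by (simp add: mult_left_mono)
    also have "\<dots> \<le> norm (x + t *\<^sub>R s) + norm x"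
      using norm_triangle_ineq4[of "x + t *\<^sub>R s" x] by simp
    finally show ?thesis by (simp add: i N_def)
  qed
  have bdd: "bdd_below (N x ` I)" for x using lb by (rule bdd_belowI2)
  have lower: "p x \<le> N x i" if "i \<in> I" for i x
    unfolding p_def using that bdd by (intro cINF_lower) auto
  have "sublinear p"
  proof (rule sublinearI)
    fix x y
    have *: "p (x + y) \<le> N x i + N y j" if iI: "i \<in> I" and jI: "j \<in> I" for i j
    proof -
      obtain t s where i: "i = (t, s)" "0 \<le> t" "s \<in> S" using iI by (auto simp: I_def)
      obtain t' s' where j: "j = (t', s')" "0 \<le> t'" "s' \<in> S" using jI by (auto simp: I_def)
      obtain w where w: "w \<in> S" "t *\<^sub>R s + t' *\<^sub>R s' = (t + t') *\<^sub>R w"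
      proof (cases "t + t' = 0")
        case True
        then have "t = 0" "t' = 0" using i j by auto
        then show ?thesis using that[OF s0] by simp
      next
        case False
        let ?w = "(t / (t + t')) *\<^sub>R s + (t' / (t + t')) *\<^sub>R s'"
        have "?w \<in> S"
          using i j False by (intro convexD[OF assms(1)]) (auto simp flip: add_divide_distrib)
        moreover have "(t + t') *\<^sub>R ?w = t *\<^sub>R s + t' *\<^sub>R s'"
          using False by (simp add: scaleR_add_right)
        ultimately show ?thesis using that by metis
      qed
      have "p (x + y) \<le> N (x + y) (t + t', w)"
        using w i j by (intro lower) (auto simp: I_def)
      also have "\<dots> = norm ((x + t *\<^sub>R s) + (y + t' *\<^sub>R s')) - (t + t') * \<delta>"
        unfolding N_def fst_conv snd_conv w(2)[symmetric] by (simp add: add_ac)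
      also have "\<dots> \<le> N x i + N y j"
        using norm_triangle_ineq[of "x + t *\<^sub>R s" "y + t' *\<^sub>R s'"]
        by (simp add: N_def i j algebra_simps)
      finally show ?thesis .
    qed
    have "p (x + y) - N y j \<le> p x" if "j \<in> I" for j
      unfolding p_def[of x] using * that by (intro cINF_greatest ne) (auto simp: algebra_simps)
    then have "p (x + y) - p x \<le> p y"
      unfolding p_def[of y] by (intro cINF_greatest ne) (auto simp: algebra_simps)
    then show "p (x + y) \<le> p x + p y" by simp
  next
    fix r :: real and x assume r: "0 < r"
    have "p (r *\<^sub>R x) / r \<le> N x i" if iI: "i \<in> I" for i
    proof -
      obtain t s where i: "i = (t, s)" "0 \<le> t" "s \<in> S" using iI by (auto simp: I_def)
      have "p (r *\<^sub>R x) \<le> N (r *\<^sub>R x) (r * t, s)"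
        using i r by (intro lower) (auto simp: I_def)
      also have "\<dots> = norm (r *\<^sub>R (x + t *\<^sub>R s)) - r * t * \<delta>"
        by (simp add: N_def scaleR_add_right)
      also have "\<dots> = r * N x i" using r by (simp add: N_def i right_diff_distrib)
      finally show ?thesis using r by (simp add: field_simps)
    qed
    then have "p (r *\<^sub>R x) / r \<le> p x"
      unfolding p_def[of x] by (intro cINF_greatest ne) auto
    then show "p (r *\<^sub>R x) \<le> r * p x" using r by (simp add: field_simps)
  next
    have "p 0 \<le> 0" using lower[of "(0, s0)" 0] s0 by (simp add: I_def N_def)
    moreover have "0 \<le> p 0"
      unfolding p_def using lb[of _ 0] by (intro cINF_greatest ne) auto
    ultimately show "p 0 = 0" by simp
  qed
  then obtain f where f: "linear f" "\<And>x. f x \<le> p x"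
    using sublinear_dominates_linear by blast
  have le: "f x \<le> norm x" for x
    using f(2)[of x] lower[of "(0, s0)" x] s0 by (simp add: I_def N_def)
  show ?thesis
  proof (rule that[OF f(1)])
    show "\<bar>f x\<bar> \<le> norm x" for x
      using le[of x] le[of "- x"] linear_neg[OF f(1), of x] by auto
    show "\<delta> \<le> f s" if "s \<in> S" for s
      using f(2)[of "- s"] lower[of "(1, s)" "- s"] that linear_neg[OF f(1), of s]
      by (simp add: I_def N_def)
  qed
qed

section \<open>The real inner product of a complex Hilbert space\<close>

text \<open>The norm needs the real part only, so all estimates become inequalities between real
  numbers. Nothing is lost for orthogonality to the range of a complex-linear map: replacing \<eta>
  by i \<eta> recovers the imaginary part.\<close>

definition rinner :: "'h::complex_hilbert \<Rightarrow> 'h \<Rightarrow> real" where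
  "rinner x y = Re (cinner x y)"

lemma rinner_commute: "rinner x y = rinner y x"
  unfolding rinner_def by (subst cinner_commute) simp

lemma rinner_self: "rinner x x = (norm x)\<^sup>2"
  by (simp add: rinner_def norm_eq_sqrt_cinner cinner_ge_zero)

lemma rinner_add_left: "rinner (x + y) z = rinner x z + rinner y z"
  by (simp add: rinner_def cinner_add_left)

lemma rinner_scaleR_left: "rinner (r *\<^sub>R x) y = r * rinner x y"
  by (simp add: rinner_def scaleR_scaleC cinner_scaleC_left)

lemma norm_add_sq: "(norm (x + y))\<^sup>2 = (norm x)\<^sup>2 + 2 * rinner x y + (norm y)\<^sup>2"
  for x y :: "'h::complex_hilbert"
  using rinner_self[of "x + y"] rinner_self[of x] rinner_self[of y]
    rinner_add_left[of x y "x + y"] rinner_add_left[of x y x] rinner_add_left[of x y y]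
    rinner_commute[of x "x + y"] rinner_commute[of y "x + y"] rinner_commute[of x y]
  by simp

text \<open>The usual order is reversed: the triangle inequality comes with the normed-space class,
  and squaring it bounds the cross term.\<close>

lemma rinner_Cauchy_Schwarz: "\<bar>rinner x y\<bar> \<le> norm x * norm y"
proof -
  have *: "rinner x y \<le> norm x * norm y" for x y :: 'a
  proof -
    have "(norm (x + y))\<^sup>2 \<le> (norm x + norm y)\<^sup>2"
      by (intro power_mono norm_triangle_ineq norm_ge_zero)
    then show ?thesis by (simp add: norm_add_sq power2_sum)
  qed
  have "rinner (- x) y = - rinner x y" using rinner_scaleR_left[of "-1" x y] by simp
  then show ?thesis using *[of x y] *[of "- x" y] by simp
qed

interpretation rinner: bounded_bilinear rinner
proof
  show "\<exists>K. \<forall>a b. norm (rinner a b) \<le> norm a * norm b * K"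
    by (intro exI[of _ 1]) (simp add: rinner_Cauchy_Schwarz)
  show "rinner a (b + b') = rinner a b + rinner a b'" for a b b' :: 'a
    by (simp add: rinner_commute[of a] rinner_add_left)
  show "rinner a (r *\<^sub>R b) = r *\<^sub>R rinner a b" for a b :: 'a and r
    by (simp add: rinner_commute[of a] rinner_scaleR_left)
qed (simp_all add: rinner_add_left rinner_scaleR_left)

lemma norm_diff_sq: "(norm (x - y))\<^sup>2 = (norm x)\<^sup>2 - 2 * rinner x y + (norm y)\<^sup>2"
  for x y :: "'h::complex_hilbert"
  using norm_add_sq[of x "- y"] by (simp add: rinner.minus_right)

text \<open>The factor 2 comes from adding the bounds for real and imaginary part, the latter being
  the real form at i x up to sign. It suffices for the boundedness of vector functionals.\<close>

lemma norm_cinner_le: "cmod (cinner x y) \<le> 2 * norm x * norm y"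
proof -
  have "Im (cinner x y) = - rinner (\<i> *\<^sub>C x) y"
    by (simp add: rinner_def cinner_scaleC_left)
  then have "\<bar>Im (cinner x y)\<bar> \<le> norm x * norm y"
    using rinner_Cauchy_Schwarz[of "\<i> *\<^sub>C x" y] by (simp add: norm_scaleC)
  then show ?thesis
    using cmod_le[of "cinner x y"] rinner_Cauchy_Schwarz[of x y] by (simp add: rinner_def)
qed

text \<open>The vector minimizes norm x ^ 2 - 2 g x: the parallelogram law makes a minimizing
  sequence Cauchy, and the vanishing first variation is the claim. Applied to \<xi> -> <a \<xi>,
  \<eta>> it will supply the adjoint of \<open>a\<close> at \<eta>.\<close>

theorem riesz_representation:
  fixes g :: "'h::complex_hilbert \<Rightarrow> real"
  assumes "bounded_linear g"
  obtains y where "\<And>x. g x = rinner x y"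
proof -
  interpret g: bounded_linear g by fact
  define q where "q x = (norm x)\<^sup>2 - 2 * g x" for x
  obtain K where K: "\<And>x. \<bar>g x\<bar> \<le> norm x * K" using g.nonneg_bounded by auto
  have lb: "- K\<^sup>2 \<le> q x" for x
  proof -
    have "0 \<le> (norm x - K)\<^sup>2" by simp
    then show ?thesis using K[of x] by (simp add: q_def power2_diff)
  qed
  define \<mu> where "\<mu> = (INF x. q x)"
  have bdd: "bdd_below (range q)" using lb by (auto intro!: bdd_belowI2)
  have lower: "\<mu> \<le> q x" for x unfolding \<mu>_def using bdd by (intro cINF_lower) auto
  have "\<exists>x. q x < \<mu> + 1 / Suc n" for n
    using cINF_less_iff[of UNIV q "\<mu> + 1 / Suc n"] bdd by (simp add: \<mu>_def)
  then obtain X where X: "\<And>n. q (X n) < \<mu> + 1 / Suc n" by metis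
  have par: "(norm (x - y))\<^sup>2 \<le> 2 * (q x - \<mu>) + 2 * (q y - \<mu>)" for x y
  proof -
    have "4 * \<mu> \<le> 4 * q ((1/2) *\<^sub>R (x + y))" using lower by simp
    also have "\<dots> = (norm (x + y))\<^sup>2 - 4 * g x - 4 * g y"
      unfolding q_def norm_scaleR g.scaleR g.add
      by (simp add: power_mult_distrib power_divide field_simps)
    finally show ?thesis by (simp add: q_def norm_add_sq norm_diff_sq)
  qed
  have "Cauchy X"
  proof (rule metric_CauchyI)
    fix e :: real assume e: "0 < e"
    obtain N :: nat where N: "4 / e\<^sup>2 < real (Suc N)" by (meson less_Suc_eq of_nat_less_iff order_less_trans reals_Archimedean2)
    have "dist (X m) (X n) < e" if "N \<le> m" "N \<le> n" for m n
    proof -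
      have le: "q (X k) - \<mu> < 1 / real (Suc N)" if "N \<le> k" for k
      proof -
        have "1 / real (Suc k) \<le> 1 / real (Suc N)" using that by (intro divide_left_mono) auto
        then show ?thesis using X[of k] by argo
      qed
      have "(norm (X m - X n))\<^sup>2 \<le> 2 * (q (X m) - \<mu>) + 2 * (q (X n) - \<mu>)" by (rule par)
      also have "\<dots> < 4 * (1 / real (Suc N))"
        using le[OF that(1)] le[OF that(2)] by argo
      also have "\<dots> < e\<^sup>2" using N e by (simp add: field_simps)
      finally show ?thesis using e by (simp add: dist_norm power2_less_imp_less)
    qed
    then show "\<exists>M. \<forall>m\<ge>M. \<forall>n\<ge>M. dist (X m) (X n) < e" by blast
  qed
  then obtain y where y: "X \<longlonglongrightarrow> y" using convergent_eq_Cauchy by (metis convergent_def)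
  have "(\<lambda>n. q (X n)) \<longlonglongrightarrow> q y"
    unfolding q_def by (intro tendsto_intros y g.tendsto)
  moreover have "(\<lambda>n. \<mu> + 1 / Suc n) \<longlonglongrightarrow> \<mu> + 0"
    using LIMSEQ_inverse_real_of_nat by (intro tendsto_intros) (simp add: inverse_eq_divide)
  ultimately have qy: "q y \<le> \<mu> + 0"
    using X by (intro LIMSEQ_le[where X = "\<lambda>n. q (X n)"]) (auto intro: less_imp_le)
  have "rinner y x = g x" for x
  proof -
    have pos: "0 \<le> 2 * t * (rinner y x - g x) + t\<^sup>2 * (norm x)\<^sup>2" for t
    proof -
      have "q y \<le> q (y + t *\<^sub>R x)" using qy lower[of "y + t *\<^sub>R x"] by simp
      then show ?thesis
        by (simp add: q_def norm_add_sq g.add g.scaleR rinner.scaleR_right power_mult_distrib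
            algebra_simps)
    qed
    define d where "d = rinner y x - g x"
    \<comment> \<open>The 1 keeps \<open>b\<close> positive at \<open>x = 0\<close>. The test value
      t = -d / b minimizes 2 t d + t^2 b, with minimum -d^2 / b.\<close>
    define b where "b = (norm x)\<^sup>2 + 1"
    have b: "0 < b" by (simp add: b_def add_nonneg_pos)
    have "0 \<le> 2 * (- d / b) * d + (- d / b)\<^sup>2 * (norm x)\<^sup>2" using pos unfolding d_def by blast
    also have "\<dots> \<le> 2 * (- d / b) * d + (- d / b)\<^sup>2 * b"
      by (intro add_left_mono mult_left_mono) (auto simp: b_def)
    also have "\<dots> = - (d\<^sup>2 / b)" using b by (simp add: field_simps power2_eq_square)
    finally have "d\<^sup>2 \<le> 0" using b by (simp add: field_simps)
    then show ?thesis by (simp add: d_def)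
  qed
  then show ?thesis using that[of y] by (metis rinner_commute)
qed

text \<open>A contraction that almost fixes \<open>w\<close> has an adjoint that almost fixes \<open>w\<close>.\<close>

lemma contraction_almost_fixing:
  fixes e :: "'h::complex_hilbert \<Rightarrow>\<^sub>L 'h"
  assumes e: "norm e \<le> 1" and R: "norm u \<le> R" "norm w \<le> R"
    and fx: "norm (e w - w) \<le> s\<^sup>2 * R" and s: "0 < s" "s \<le> 1"
  shows "\<bar>rinner (e u - u) w\<bar> \<le> 3 * s * R\<^sup>2"
proof -
  have R0: "0 \<le> R" using R norm_ge_zero order_trans by blast
  have contr: "norm (e z) \<le> norm z" for z
    using norm_blinfun[of e z] e by (meson mult_left_le_one_le norm_ge_zero order_trans)
  have upper: "rinner (e v - v) w \<le> 3 * s * R\<^sup>2" if v: "norm v \<le> R" for v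
  proof -
    \<comment> \<open>Contractivity is tested on w + s v. The wanted difference carries a factor s,
      whereas the loss norm w ^ 2 - norm (e w) ^ 2 and the remaining errors are of order s^2, which
      is why the hypothesis asks for s^2. Division by 2 s leaves (3 s + 2 s^2) R^2 / 2, rounded up
      to 3 s R^2.\<close>
    have "(norm (e w + s *\<^sub>R e v))\<^sup>2 \<le> (norm (w + s *\<^sub>R v))\<^sup>2"
      using contr[of "w + s *\<^sub>R v"] by (intro power_mono) (auto simp: blinfun.add_right blinfun.scaleR_right)
    then have 1: "(norm (e w))\<^sup>2 + 2 * s * rinner (e w) (e v) + s\<^sup>2 * (norm (e v))\<^sup>2
        \<le> (norm w)\<^sup>2 + 2 * s * rinner w v + s\<^sup>2 * (norm v)\<^sup>2"
      by (simp add: norm_add_sq rinner.scaleR_right power_mult_distrib mult.assoc)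
    have "(norm w)\<^sup>2 - (norm (e w))\<^sup>2 = (norm w - norm (e w)) * (norm w + norm (e w))"
      by (simp add: power2_eq_square algebra_simps)
    also have "\<dots> \<le> (s\<^sup>2 * R) * (R + R)"
      using fx R contr[of w] norm_triangle_ineq2[of w "e w"] R0
      by (intro mult_mono) (auto simp: norm_minus_commute)
    finally have 2: "(norm w)\<^sup>2 - (norm (e w))\<^sup>2 \<le> 2 * s\<^sup>2 * R\<^sup>2"
      by (simp add: power2_eq_square algebra_simps)
    have "\<bar>rinner (e w - w) (e v)\<bar> \<le> norm (e w - w) * norm (e v)" by (rule rinner_Cauchy_Schwarz)
    also have "\<dots> \<le> (s\<^sup>2 * R) * R"
      using fx contr[of v] v R0 by (intro mult_mono) auto
    finally have 3: "rinner w (e v) \<le> rinner (e w) (e v) + s\<^sup>2 * R\<^sup>2"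
      by (simp add: rinner.diff_left power2_eq_square algebra_simps)
    have 4: "s\<^sup>2 * (norm v)\<^sup>2 \<le> s\<^sup>2 * R\<^sup>2"
      using v by (intro mult_left_mono power_mono) auto
    have "s * rinner w (e v) \<le> s * (rinner (e w) (e v) + s\<^sup>2 * R\<^sup>2)"
      using 3 s by (intro mult_left_mono) auto
    then have "s * rinner w (e v) \<le> s * rinner (e w) (e v) + s * (s\<^sup>2 * R\<^sup>2)"
      by (simp only: distrib_left)
    moreover have "0 \<le> s\<^sup>2 * (norm (e v))\<^sup>2" by simp
    ultimately have "2 * (s * rinner w (e v)) - 2 * (s * rinner w v)
        \<le> 3 * (s\<^sup>2 * R\<^sup>2) + 2 * (s * (s\<^sup>2 * R\<^sup>2))"
      using 1 2 4 unfolding mult.assoc by linarith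
    then have "2 * (s * (rinner w (e v) - rinner w v)) \<le> 3 * (s\<^sup>2 * R\<^sup>2) + 2 * (s * (s\<^sup>2 * R\<^sup>2))"
      by (simp add: right_diff_distrib)
    also have "\<dots> = s * (3 * (s * R\<^sup>2) + 2 * (s\<^sup>2 * R\<^sup>2))"
      by (simp add: power2_eq_square algebra_simps)
    finally have "2 * (rinner w (e v) - rinner w v) \<le> 3 * (s * R\<^sup>2) + 2 * (s\<^sup>2 * R\<^sup>2)"
      using s by (simp add: mult.left_commute)
    moreover have "s\<^sup>2 * R\<^sup>2 \<le> s * R\<^sup>2"
      using s by (intro mult_right_mono) (auto simp: power2_eq_square mult_le_one)
    moreover have "0 \<le> s * R\<^sup>2" using s by simp
    ultimately show ?thesis
      by (simp add: rinner.diff_left rinner_commute[of w])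
  qed
  show ?thesis
    using upper[OF R(1)] upper[of "- u"] R(1)
    by (simp add: blinfun.minus_right rinner.diff_left rinner.minus_left)
qed

section \<open>Weak topologies on an operator algebra and its bidual\<close>

lemma scaleC_op_apply [simp]: "scaleC_op c T x = c *\<^sub>C T x"
  by (simp add: scaleC_op.rep_eq)

lemma scaleR_eq_scaleC_op: "r *\<^sub>R T = scaleC_op (complex_of_real r) T"
  by (intro blinfun_eqI) (simp add: scaleR_scaleC blinfun.scaleR_left)

lemma scaleC_op_Complex: "scaleC_op c T = Re c *\<^sub>R T + Im c *\<^sub>R scaleC_op \<i> T"
proof (rule blinfun_eqI)
  fix x
  have "c *\<^sub>C T x = (complex_of_real (Re c) + complex_of_real (Im c) * \<i>) *\<^sub>C T x"
    by (metis complex_eq mult.commute)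
  then show "scaleC_op c T x = (Re c *\<^sub>R T + Im c *\<^sub>R scaleC_op \<i> T) x"
    by (simp add: blinfun.add_left blinfun.scaleR_left scaleR_scaleC scaleC_add_left scaleC_scaleC)
qed

lemma norm_scaleC_op_ii: "norm (scaleC_op \<i> T) \<le> norm T"
  by (rule norm_blinfun_bound) (auto simp: norm_scaleC norm_blinfun)

lemma compose_assoc: "(S o\<^sub>L T) o\<^sub>L U = S o\<^sub>L (T o\<^sub>L U)"
  by (intro blinfun_eqI) simp

lemma scaleC_op_compose_left: "scaleC_op c S o\<^sub>L T = scaleC_op c (S o\<^sub>L T)"
  by (intro blinfun_eqI) simp

lemma norm_compose_le_right: "norm T \<le> 1 \<Longrightarrow> norm (S o\<^sub>L T) \<le> norm S"
  for S :: "'b::real_normed_vector \<Rightarrow>\<^sub>L 'c::real_normed_vector" and T :: "'a::real_normed_vector \<Rightarrow>\<^sub>L 'b"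
  using norm_blinfun_compose[of S T] mult_left_mono[of "norm T" 1 "norm S"] by simp

lemma contraction_apply: "norm S \<le> 1 \<Longrightarrow> norm (S x) \<le> norm x"
  for S :: "'a::real_normed_vector \<Rightarrow>\<^sub>L 'b::real_normed_vector"
  using norm_blinfun[of S x] mult_right_mono[of "norm S" 1 "norm x"] by simp

lemmas compose_diff_left = bounded_bilinear.diff_left[OF bounded_bilinear_blinfun_compose]
lemmas compose_add_left = bounded_bilinear.add_left[OF bounded_bilinear_blinfun_compose]
lemmas compose_add_right = bounded_bilinear.add_right[OF bounded_bilinear_blinfun_compose]
lemmas compose_tendsto = bounded_bilinear.tendsto[OF bounded_bilinear_blinfun_compose]

context
  fixes A :: "('h::complex_hilbert \<Rightarrow>\<^sub>L 'h) set"
  assumes A: "operator_algebra A"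
begin

lemma alg_zero: "0 \<in> A" and alg_add: "S \<in> A \<Longrightarrow> T \<in> A \<Longrightarrow> S + T \<in> A"
  and alg_scaleC: "T \<in> A \<Longrightarrow> scaleC_op c T \<in> A"
  and alg_compose: "S \<in> A \<Longrightarrow> T \<in> A \<Longrightarrow> S o\<^sub>L T \<in> A"
  and alg_closed: "closed A"
  and alg_homogeneous: "T \<in> A \<Longrightarrow> T (c *\<^sub>C x) = c *\<^sub>C T x"
  using A by (auto simp: operator_algebra_def)

lemma alg_scaleR: "T \<in> A \<Longrightarrow> r *\<^sub>R T \<in> A"
  by (simp add: scaleR_eq_scaleC_op alg_scaleC)

lemma alg_diff: "S \<in> A \<Longrightarrow> T \<in> A \<Longrightarrow> S - T \<in> A"
  using alg_add[of S "(-1) *\<^sub>R T"] alg_scaleR[of T "-1"] by simp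

lemma alg_compose_scaleC: "S \<in> A \<Longrightarrow> S o\<^sub>L scaleC_op c T = scaleC_op c (S o\<^sub>L T)"
  by (intro blinfun_eqI) (simp add: alg_homogeneous)

section \<open>The dual of the algebra: bounds, limits, translates\<close>

lemma dualI:
  assumes "\<And>x y. x \<in> A \<Longrightarrow> y \<in> A \<Longrightarrow> f (x + y) = f x + f y"
    and "\<And>c x. x \<in> A \<Longrightarrow> f (scaleC_op c x) = c * f x"
    and "\<And>x. x \<in> A \<Longrightarrow> cmod (f x) \<le> K * norm x"
    and "\<And>x. x \<notin> A \<Longrightarrow> f x = 0"
  shows "f \<in> dual A"
  using assms unfolding dual_def cdual_def by blast

lemma dual_add: "f \<in> dual A \<Longrightarrow> x \<in> A \<Longrightarrow> y \<in> A \<Longrightarrow> f (x + y) = f x + f y"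
  and dual_scaleC: "f \<in> dual A \<Longrightarrow> x \<in> A \<Longrightarrow> f (scaleC_op c x) = c * f x"
  and dual_outside: "f \<in> dual A \<Longrightarrow> x \<notin> A \<Longrightarrow> f x = 0"
  by (auto simp: dual_def cdual_def)

lemma dual_diff:
  assumes "f \<in> dual A" "x \<in> A" "y \<in> A"
  shows "f (x - y) = f x - f y"
  using dual_add[OF assms(1), of "x - y" y] assms alg_diff by simp

lemma dual_norm_bounds:
  assumes f: "f \<in> dual A"
  shows "0 \<le> dual_norm A f" and "x \<in> A \<Longrightarrow> cmod (f x) \<le> dual_norm A f * norm x"
proof -
  obtain K where K: "\<And>x. x \<in> A \<Longrightarrow> cmod (f x) \<le> K * norm x"
    using f unfolding dual_def cdual_def by blast
  have bdd: "bdd_above ((\<lambda>x. cmod (f x)) ` {x \<in> A. norm x \<le> 1})"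
  proof (rule bdd_aboveI2)
    fix x assume x: "x \<in> {x \<in> A. norm x \<le> 1}"
    then have "cmod (f x) \<le> \<bar>K\<bar> * norm x"
      using K[of x] mult_right_mono[OF abs_ge_self norm_ge_zero, of K x] x by auto
    then show "cmod (f x) \<le> \<bar>K\<bar>" using x mult_left_mono[of "norm x" 1 "\<bar>K\<bar>"] by simp
  qed
  have upper: "cmod (f x) \<le> dual_norm A f" if "x \<in> A" "norm x \<le> 1" for x
    unfolding dual_norm_def cdual_norm_def using that by (intro cSUP_upper bdd) auto
  show "0 \<le> dual_norm A f" using upper[OF alg_zero] by (auto intro: order_trans[OF norm_ge_zero])
  show "cmod (f x) \<le> dual_norm A f * norm x" if x: "x \<in> A"
  proof (cases "x = 0")
    case True
    then show ?thesis using K[OF alg_zero] by simp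
  next
    case False
    have "f (inverse (norm x) *\<^sub>R x) = complex_of_real (inverse (norm x)) * f x"
      unfolding scaleR_eq_scaleC_op by (rule dual_scaleC[OF f x])
    moreover have "cmod (f (inverse (norm x) *\<^sub>R x)) \<le> dual_norm A f"
      using x False by (intro upper alg_scaleR) auto
    ultimately have "inverse (norm x) * cmod (f x) \<le> dual_norm A f"
      by (simp add: norm_mult norm_inverse)
    then show ?thesis using False by (simp add: field_simps)
  qed
qed

lemma dual_norm_least: "(\<And>x. x \<in> A \<Longrightarrow> norm x \<le> 1 \<Longrightarrow> cmod (f x) \<le> K) \<Longrightarrow> dual_norm A f \<le> K"
  unfolding dual_norm_def cdual_norm_def
  using alg_zero by (intro cSUP_least) (auto intro: exI[of _ 0])

lemma dual_tendsto:
  assumes f: "f \<in> dual A" and X: "(X \<longlongrightarrow> l) F" "\<forall>\<^sub>F t in F. X t \<in> A" and l: "l \<in> A"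
  shows "((\<lambda>t. f (X t)) \<longlongrightarrow> f l) F"
proof (rule Lim_null[THEN iffD2], rule Lim_null_comparison)
  show "\<forall>\<^sub>F t in F. norm (f (X t) - f l) \<le> dual_norm A f * norm (X t - l)"
    using X(2)
  proof eventually_elim
    case (elim t)
    then show ?case
      using dual_norm_bounds(2)[OF f, of "X t - l"] dual_diff[OF f elim l] alg_diff[OF elim l] by simp
  qed
  have "((\<lambda>t. X t - l) \<longlongrightarrow> 0) F" using X(1) by (rule Lim_null[THEN iffD1])
  then show "((\<lambda>t. dual_norm A f * norm (X t - l)) \<longlongrightarrow> 0) F"
    by (intro tendsto_mult_right_zero tendsto_norm_zero)
qed

text \<open>The functionals f (a _ b), f (_ b) and f (a _). Evaluating an element of the bidual at
  them amounts to multiplying it by \<open>a\<close> or \<open>b\<close>, and so turns a weak* limit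
  of x into weak limits of a x b, x b and a x.\<close>

lemma dual_translate:
  assumes f: "f \<in> dual A" and a: "a \<in> A" and b: "b \<in> A"
  shows "(\<lambda>x. if x \<in> A then f (a o\<^sub>L x o\<^sub>L b) else 0) \<in> dual A"
    and "(\<lambda>x. if x \<in> A then f (x o\<^sub>L b) else 0) \<in> dual A"
    and "dual_act_alg A f a \<in> dual A"
proof -
  have bound: "cmod (f T) \<le> dual_norm A f * C * norm x"
    if "T \<in> A" "norm T \<le> C * norm x" for T C and x :: "'h \<Rightarrow>\<^sub>L 'h"
    using dual_norm_bounds[OF f] that
    by (metis (no_types, lifting) mult.assoc mult_left_mono order_trans)
  have "norm (a o\<^sub>L x o\<^sub>L b) \<le> norm a * norm b * norm x" for x :: "'h \<Rightarrow>\<^sub>L 'h"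
    using norm_blinfun_compose[of "a o\<^sub>L x" b] norm_blinfun_compose[of a x]
      mult_right_mono[of "norm (a o\<^sub>L x)" "norm a * norm x" "norm b"]
    by (simp add: mult_ac)
  then show "(\<lambda>x. if x \<in> A then f (a o\<^sub>L x o\<^sub>L b) else 0) \<in> dual A"
    using a b
    by (intro dualI[where K = "dual_norm A f * (norm a * norm b)"])
      (auto simp: alg_add alg_scaleC alg_compose alg_compose_scaleC scaleC_op_compose_left
        dual_add[OF f] dual_scaleC[OF f] compose_add_left compose_add_right intro!: bound)
  have xb: "norm (x o\<^sub>L b) \<le> norm b * norm x" for x :: "'h \<Rightarrow>\<^sub>L 'h"
    using norm_blinfun_compose[of x b] by (simp add: mult.commute)
  then show "(\<lambda>x. if x \<in> A then f (x o\<^sub>L b) else 0) \<in> dual A"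
    using b xb
    by (intro dualI[where K = "dual_norm A f * norm b"])
      (auto simp: alg_add alg_scaleC alg_compose scaleC_op_compose_left
        dual_add[OF f] dual_scaleC[OF f] compose_add_left intro!: bound)
  show "dual_act_alg A f a \<in> dual A"
    unfolding dual_act_alg_def using a norm_blinfun_compose[of a]
    by (intro dualI[where K = "dual_norm A f * norm a"])
      (auto simp: alg_add alg_scaleC alg_compose alg_compose_scaleC
        dual_add[OF f] dual_scaleC[OF f] compose_add_right intro!: bound)
qed

lemma vector_functional_in_dual: "(\<lambda>x. if x \<in> A then cinner (x \<xi>) \<eta> else 0) \<in> dual A"
proof (rule dualI[where K = "2 * norm \<xi> * norm \<eta>"])
  fix x assume "x \<in> A"
  have "cmod (cinner (x \<xi>) \<eta>) \<le> 2 * norm (x \<xi>) * norm \<eta>" by (rule norm_cinner_le)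
  also have "\<dots> \<le> 2 * (norm x * norm \<xi>) * norm \<eta>"
    by (intro mult_left_mono mult_right_mono norm_blinfun) auto
  finally show "cmod (if x \<in> A then cinner (x \<xi>) \<eta> else 0) \<le> 2 * norm \<xi> * norm \<eta> * norm x"
    by (simp add: mult_ac)
qed (auto simp: alg_add alg_scaleC blinfun.add_left cinner_add_left cinner_scaleC_left)

text \<open>Separation yields a real functional; g x - i g (i x) is the complex-linear functional
  with real part \<open>g\<close>. Membership in the dual asks for some bound, so the crude constant
  2 does.\<close>

lemma real_functional_in_dual:
  assumes g: "linear g" "\<And>x. \<bar>g x\<bar> \<le> norm x"
  shows "(\<lambda>x. if x \<in> A then Complex (g x) (- g (scaleC_op \<i> x)) else 0) \<in> dual A"
proof (rule dualI[where K = 2])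
  fix x y assume xy: "x \<in> A" "y \<in> A"
  have "scaleC_op \<i> (x + y) = scaleC_op \<i> x + scaleC_op \<i> y"
    by (intro blinfun_eqI) (simp add: blinfun.add_left scaleC_add_right)
  then show "(if x + y \<in> A then Complex (g (x + y)) (- g (scaleC_op \<i> (x + y))) else 0) =
      (if x \<in> A then Complex (g x) (- g (scaleC_op \<i> x)) else 0) +
      (if y \<in> A then Complex (g y) (- g (scaleC_op \<i> y)) else 0)"
    using xy by (simp add: alg_add linear_add[OF g(1)] complex_eq_iff)
next
  fix c x assume x: "x \<in> A"
  have "scaleC_op \<i> (scaleC_op c x) = Re c *\<^sub>R scaleC_op \<i> x - Im c *\<^sub>R x"
    using scaleC_op_Complex[of "\<i> * c" x, simplified]
    by (metis blinfun_eqI scaleC_op_apply scaleC_scaleC)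
  then show "(if scaleC_op c x \<in> A
       then Complex (g (scaleC_op c x)) (- g (scaleC_op \<i> (scaleC_op c x))) else 0) =
      c * (if x \<in> A then Complex (g x) (- g (scaleC_op \<i> x)) else 0)"
    using x alg_scaleC[OF x, of c] scaleC_op_Complex[of c x]
    by (simp add: complex_eq_iff linear_add[OF g(1)] linear_diff[OF g(1)] linear_scale[OF g(1)])
next
  fix x assume x: "x \<in> A"
  show "cmod (if x \<in> A then Complex (g x) (- g (scaleC_op \<i> x)) else 0) \<le> 2 * norm x"
    using x cmod_le[of "Complex (g x) (- g (scaleC_op \<i> x))"] g(2)[of x] g(2)[of "scaleC_op \<i> x"]
      norm_scaleC_op_ii[of x] by simp
qed simp

text \<open>Mazur's theorem: if all of \<open>S\<close> stayed \<epsilon> away from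
  \<open>m\<close>, the real functional separating S - m from 0 would keep Re (f (X t)) at least
  \<epsilon> above Re (f m), against the weak convergence.\<close>

lemma weak_limit_approximation:
  assumes F: "F \<noteq> bot" and S: "convex S" "S \<subseteq> A" and X: "\<forall>\<^sub>F t in F. X t \<in> S" and m: "m \<in> A"
    and lim: "\<And>f. f \<in> dual A \<Longrightarrow> ((\<lambda>t. f (X t)) \<longlongrightarrow> f m) F" and \<epsilon>: "0 < \<epsilon>"
  obtains s where "s \<in> S" "norm (s - m) < \<epsilon>"
proof (rule ccontr)
  assume contra: "\<not> thesis"
  define S' where "S' = (\<lambda>s. s - m) ` S"
  have far: "\<epsilon> \<le> norm s" if "s \<in> S'" for s
    using that contra \<open>\<And>s. s \<in> S \<Longrightarrow> norm (s - m) < \<epsilon> \<Longrightarrow> thesis\<close> by (force simp: S'_def)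
  have "convex S'" unfolding S'_def using S(1) by (rule convex_translation_subtract)
  moreover have "S' \<noteq> {}"
    using eventually_happens'[OF F X] by (auto simp: S'_def)
  ultimately obtain g where g: "linear g" "\<And>x. \<bar>g x\<bar> \<le> norm x" "\<And>s. s \<in> S' \<Longrightarrow> \<epsilon> \<le> g s"
    using convex_separation_from_zero[of S' \<epsilon>] far by blast
  define f where "f x = (if x \<in> A then Complex (g x) (- g (scaleC_op \<i> x)) else 0)" for x
  have "f \<in> dual A" unfolding f_def using g(1,2) by (rule real_functional_in_dual)
  then have "((\<lambda>t. Re (f (X t))) \<longlongrightarrow> Re (f m)) F" by (intro tendsto_Re lim)
  moreover have "\<forall>\<^sub>F t in F. Re (f m) + \<epsilon> \<le> Re (f (X t))"
    using X
  proof eventually_elim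
    case (elim t)
    then show ?case using g(3)[of "X t - m"] S(2) m
      by (auto simp: f_def S'_def linear_diff[OF g(1)])
  qed
  ultimately have "Re (f m) + \<epsilon> \<le> Re (f m)"
    using F by (intro tendsto_lowerbound[where f = "\<lambda>t. Re (f (X t))"])
  then show False using \<epsilon> by simp
qed

text \<open>The Banach--Alaoglu theorem, by Tychonoff's theorem applied to the values on \<open>dual A\<close>.\<close>

lemma weak_star_cluster_point:
  assumes F: "F \<noteq> bot" and X: "\<forall>\<^sub>F t in F. X t \<in> A \<and> norm (X t) \<le> 1"
  obtains \<phi> G where "\<phi> \<in> bidual A" "bidual_norm A \<phi> \<le> 1" "G \<le> F" "G \<noteq> bot"
    "\<And>f. f \<in> dual A \<Longrightarrow> ((\<lambda>t. f (X t)) \<longlongrightarrow> \<phi> f) G"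
proof -
  \<comment> \<open>Outside \<open>dual A\<close> the coordinate is pinned to 0, the default value
    of \<open>canon\<close>, so that \<open>K\<close> is a compact product over all
    functions.\<close>
  define K where "K = PiE UNIV (\<lambda>f. if f \<in> dual A then cball (0::complex) (dual_norm A f) else {0})"
  define Y where "Y t = canon A (X t)" for t
  have "compactin (product_topology (\<lambda>_. euclidean) UNIV) K"
    unfolding K_def by (subst compactin_PiE) (auto simp: compactin_euclidean_iff)
  then have "compact K" by (simp add: euclidean_product_topology compactin_euclidean_iff)
  moreover have "\<forall>\<^sub>F y in filtermap Y F. y \<in> K"
    unfolding eventually_filtermap using X
  proof eventually_elim
    case (elim t)
    have "cmod (f (X t)) \<le> dual_norm A f" if "f \<in> dual A" for f
      using dual_norm_bounds[OF that] elim mult_left_mono[of "norm (X t)" 1 "dual_norm A f"]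
      by (metis mult.right_neutral order_trans)
    then show ?case by (auto simp: K_def Y_def canon_def)
  qed
  ultimately obtain \<phi> where \<phi>: "\<phi> \<in> K" and ne: "inf (nhds \<phi>) (filtermap Y F) \<noteq> bot"
    using F compact_filter[of K] filtermap_bot_iff[of Y F] by blast
  \<comment> \<open>The filter form of a subnet: \<open>F\<close> restricted to where
    \<open>Y\<close> enters the neighbourhoods of the cluster point.\<close>
  define G where "G = inf F (filtercomap Y (nhds \<phi>))"
  have G: "G \<noteq> bot"
  proof
    assume "G = bot"
    then have "eventually (\<lambda>_. False) G" by simp
    then obtain P Q where PQ: "eventually P F" "eventually Q (nhds \<phi>)" "\<And>t. P t \<Longrightarrow> \<not> Q (Y t)"
      unfolding G_def eventually_inf eventually_filtercomap by blast
    have "eventually (\<lambda>y. \<not> Q y) (filtermap Y F)"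
      unfolding eventually_filtermap using PQ(1) by eventually_elim (use PQ(3) in blast)
    then have "eventually (\<lambda>_. False) (inf (nhds \<phi>) (filtermap Y F))"
      unfolding eventually_inf using PQ(2) by blast
    then show False using ne by (simp add: trivial_limit_def)
  qed
  have "filterlim Y (nhds \<phi>) G"
    unfolding G_def filterlim_def by (meson filtermap_filtercomap filtermap_mono inf_le2 order_trans)
  then have lim': "((\<lambda>t. Y t f) \<longlongrightarrow> \<phi> f) G" for f
    by (rule tendsto_compose[rotated])
      (metis (mono_tags, lifting) UNIV_I continuous_on_def continuous_on_product_coordinates)
  have lim: "((\<lambda>t. f (X t)) \<longlongrightarrow> \<phi> f) G" if "f \<in> dual A" for f
    using lim'[of f] that by (simp add: Y_def canon_def)
  have XG: "\<forall>\<^sub>F t in G. X t \<in> A"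
    using X by (auto simp: G_def intro!: filter_leD[OF inf_le1] elim: eventually_mono)
  have bound: "cmod (\<phi> f) \<le> dual_norm A f" if "f \<in> dual A" for f
    using \<phi> that by (auto simp: K_def PiE_def Pi_def split: if_splits dest!: spec[of _ f])
  have "\<phi> \<in> bidual A"
    unfolding bidual_def cdual_def
  proof (intro CollectI conjI ballI allI impI exI[of _ 1])
    fix f g assume fg: "f \<in> dual A" "g \<in> dual A"
    have "f + g \<in> dual A"
    proof (rule dualI[where K = "dual_norm A f + dual_norm A g"])
      show "cmod ((f + g) x) \<le> (dual_norm A f + dual_norm A g) * norm x" if "x \<in> A" for x
        using dual_norm_bounds(2)[OF fg(1) that] dual_norm_bounds(2)[OF fg(2) that]
          norm_triangle_ineq[of "f x" "g x"] by (simp add: algebra_simps)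
    qed (use fg in \<open>auto simp: dual_add dual_scaleC dual_outside algebra_simps\<close>)
    then have "((\<lambda>t. f (X t) + g (X t)) \<longlongrightarrow> \<phi> (f + g)) G" using lim by fastforce
    moreover have "((\<lambda>t. f (X t) + g (X t)) \<longlongrightarrow> \<phi> f + \<phi> g) G" by (intro tendsto_add lim fg)
    ultimately show "\<phi> (f + g) = \<phi> f + \<phi> g" using G tendsto_unique by blast
  next
    fix c f assume f: "f \<in> dual A"
    have "(\<lambda>x. c * f x) \<in> dual A"
    proof (rule dualI[where K = "cmod c * dual_norm A f"])
      show "cmod (c * f x) \<le> cmod c * dual_norm A f * norm x" if "x \<in> A" for x
        using dual_norm_bounds(2)[OF f that] by (simp add: norm_mult mult.assoc mult_left_mono)
    qed (use f in \<open>auto simp: dual_add dual_scaleC dual_outside algebra_simps\<close>)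
    then have "((\<lambda>t. c * f (X t)) \<longlongrightarrow> \<phi> (\<lambda>x. c * f x)) G" by (rule lim)
    moreover have "((\<lambda>t. c * f (X t)) \<longlongrightarrow> c * \<phi> f) G" by (intro tendsto_mult_left lim f)
    ultimately show "\<phi> (\<lambda>x. c * f x) = c * \<phi> f" using G tendsto_unique by blast
  next
    fix f assume "f \<in> dual A"
    then show "cmod (\<phi> f) \<le> 1 * dual_norm A f" using bound by simp
  next
    fix f assume "f \<notin> dual A"
    then show "\<phi> f = 0" using \<phi> by (auto simp: K_def PiE_def Pi_def split: if_splits dest!: spec[of _ f])
  qed
  moreover have "bidual_norm A \<phi> \<le> 1"
    unfolding bidual_norm_def cdual_norm_def
  proof (rule cSUP_least)
    have "(\<lambda>x. 0) \<in> dual A" by (rule dualI[where K = 0]) auto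
    moreover have "dual_norm A (\<lambda>x. 0) \<le> 1"
      by (rule dual_norm_least) simp
    ultimately show "{f \<in> dual A. dual_norm A f \<le> 1} \<noteq> {}" by blast
  qed (use bound in \<open>auto intro: order_trans\<close>)
  ultimately show ?thesis using that[of \<phi> G] G lim by (simp add: G_def)
qed

section \<open>Arens products with elements of the algebra\<close>

lemma bidual_act_in_dual:
  assumes \<psi>: "\<psi> \<in> bidual A" and f: "f \<in> dual A"
  shows "bidual_act_dual A \<psi> f \<in> dual A"
proof -
  obtain K where K: "\<And>g. g \<in> dual A \<Longrightarrow> cmod (\<psi> g) \<le> K * dual_norm A g"
    and add: "\<And>g h. g \<in> dual A \<Longrightarrow> h \<in> dual A \<Longrightarrow> \<psi> (g + h) = \<psi> g + \<psi> h"
    and scale: "\<And>c g. g \<in> dual A \<Longrightarrow> \<psi> (\<lambda>x. c * g x) = c * \<psi> g"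
    using \<psi> unfolding bidual_def cdual_def by blast
  have act: "dual_act_alg A f a \<in> dual A" if "a \<in> A" for a
    using dual_translate(3)[OF f that that] .
  show ?thesis
    unfolding bidual_act_dual_def
  proof (rule dualI[where K = "\<bar>K\<bar> * dual_norm A f"])
    fix x y assume xy: "x \<in> A" "y \<in> A"
    have "dual_act_alg A f (x + y) = dual_act_alg A f x + dual_act_alg A f y"
      using xy by (auto simp: fun_eq_iff dual_act_alg_def compose_add_left dual_add[OF f] alg_compose)
    then show "(if x + y \<in> A then \<psi> (dual_act_alg A f (x + y)) else 0) =
        (if x \<in> A then \<psi> (dual_act_alg A f x) else 0) + (if y \<in> A then \<psi> (dual_act_alg A f y) else 0)"
      using xy by (simp add: alg_add add act)
  next
    fix c x assume x: "x \<in> A"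
    have "dual_act_alg A f (scaleC_op c x) = (\<lambda>y. c * dual_act_alg A f x y)"
      using x by (auto simp: fun_eq_iff dual_act_alg_def scaleC_op_compose_left dual_scaleC[OF f] alg_compose)
    then show "(if scaleC_op c x \<in> A then \<psi> (dual_act_alg A f (scaleC_op c x)) else 0) =
        c * (if x \<in> A then \<psi> (dual_act_alg A f x) else 0)"
      using x by (simp add: alg_scaleC scale act)
  next
    fix x assume x: "x \<in> A"
    have "cmod (\<psi> (dual_act_alg A f x)) \<le> K * dual_norm A (dual_act_alg A f x)"
      by (intro K act x)
    also have "\<dots> \<le> \<bar>K\<bar> * dual_norm A (dual_act_alg A f x)"
      by (intro mult_right_mono dual_norm_bounds(1) act x) simp
    also have "dual_norm A (dual_act_alg A f x) \<le> dual_norm A f * norm x"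
    proof (rule dual_norm_least)
      fix y assume y: "y \<in> A" "norm y \<le> 1"
      then have "cmod (f (x o\<^sub>L y)) \<le> dual_norm A f * norm (x o\<^sub>L y)"
        using x by (intro dual_norm_bounds(2) f alg_compose) auto
      also have "\<dots> \<le> dual_norm A f * norm x"
        using y by (intro mult_left_mono norm_compose_le_right dual_norm_bounds(1) f) auto
      finally show "cmod (dual_act_alg A f x y) \<le> dual_norm A f * norm x"
        using y by (simp add: dual_act_alg_def)
    qed
    then have "\<bar>K\<bar> * dual_norm A (dual_act_alg A f x) \<le> \<bar>K\<bar> * (dual_norm A f * norm x)"
      by (intro mult_left_mono) auto
    finally show "cmod (if x \<in> A then \<psi> (dual_act_alg A f x) else 0) \<le> \<bar>K\<bar> * dual_norm A f * norm x"
      using x by (simp add: mult.assoc)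
  qed auto
qed

lemma arens_canon_right:
  assumes b: "b \<in> A" and f: "f \<in> dual A"
  shows "arens A \<phi> (canon A b) f = \<phi> (\<lambda>x. if x \<in> A then f (x o\<^sub>L b) else 0)"
proof -
  have "canon A b (dual_act_alg A f x) = f (x o\<^sub>L b)" if "x \<in> A" for x
    using dual_translate(3)[OF f that b] b by (simp add: canon_def dual_act_alg_def)
  then have "bidual_act_dual A (canon A b) f = (\<lambda>x. if x \<in> A then f (x o\<^sub>L b) else 0)"
    by (auto simp: bidual_act_dual_def fun_eq_iff)
  then show ?thesis using f by (simp add: arens_def)
qed

text \<open>Membership of \<psi> in the bidual puts the functional \<psi> \<cdot> f into the dual,
  outside of which \<open>canon\<close> returns 0.\<close>

lemma arens_canon_left:
  assumes a: "a \<in> A" and \<psi>: "\<psi> \<in> bidual A" and f: "f \<in> dual A"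
  shows "arens A (canon A a) \<psi> f = \<psi> (dual_act_alg A f a)"
  using bidual_act_in_dual[OF \<psi> f] a f by (simp add: arens_def canon_def bidual_act_dual_def)

text \<open>Heredity makes a \<phi> b an element \<open>m\<close> of \<open>A\<close>. As f (a _ b)
  is again in the dual, weak* convergence of \<open>X\<close> to \<phi> becomes weak convergence of
  a X b to \<open>m\<close> inside \<open>A\<close>, to which Mazur's theorem applies.\<close>

lemma weak_limit_sandwich:
  assumes hered: "hereditary_in_bidual A" and a: "a \<in> A" and b: "b \<in> A"
    and \<phi>: "\<phi> \<in> bidual A" and X: "\<forall>\<^sub>F t in G. X t \<in> A"
    and lim: "\<And>f. f \<in> dual A \<Longrightarrow> ((\<lambda>t. f (X t)) \<longlongrightarrow> \<phi> f) G"
  obtains m where "m \<in> A" "\<And>f. f \<in> dual A \<Longrightarrow> ((\<lambda>t. f (a o\<^sub>L X t o\<^sub>L b)) \<longlongrightarrow> f m) G"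
proof -
  obtain m where m: "m \<in> A" "arens A (arens A (canon A a) \<phi>) (canon A b) = canon A m"
    using hered a b \<phi> unfolding hereditary_in_bidual_def by blast
  have "((\<lambda>t. f (a o\<^sub>L X t o\<^sub>L b)) \<longlongrightarrow> f m) G" if f: "f \<in> dual A" for f
  proof -
    let ?g = "\<lambda>x. if x \<in> A then f (a o\<^sub>L x o\<^sub>L b) else 0"
    have "f m = arens A (arens A (canon A a) \<phi>) (canon A b) f"
      using m f by (simp add: canon_def)
    also have "\<dots> = arens A (canon A a) \<phi> (\<lambda>x. if x \<in> A then f (x o\<^sub>L b) else 0)"
      by (rule arens_canon_right[OF b f])
    also have "\<dots> = \<phi> (dual_act_alg A (\<lambda>x. if x \<in> A then f (x o\<^sub>L b) else 0) a)"
      by (rule arens_canon_left[OF a \<phi> dual_translate(2)[OF f a b]])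
    also have "dual_act_alg A (\<lambda>x. if x \<in> A then f (x o\<^sub>L b) else 0) a = ?g"
      using a by (auto simp: dual_act_alg_def fun_eq_iff alg_compose)
    finally have "f m = \<phi> ?g" .
    then have "((\<lambda>t. ?g (X t)) \<longlongrightarrow> f m) G"
      using lim[OF dual_translate(1)[OF f a b]] by simp
    moreover have "\<forall>\<^sub>F t in G. ?g (X t) = f (a o\<^sub>L X t o\<^sub>L b)"
      using X by eventually_elim simp
    ultimately show ?thesis using Lim_transform_eventually by fast
  qed
  with m(1) show ?thesis by (rule that)
qed

end

section \<open>Left multiplication by the support projection of a right ideal\<close>

text \<open>The form \<open>h\<close> stands for \<open>b\<^sup>* p b\<close>, where \<open>p\<close> is the support projection of \<open>J\<close>.\<close>

definition approx_unit ::
    "('h::complex_hilbert \<Rightarrow>\<^sub>L 'h) set \<Rightarrow> ('h \<Rightarrow>\<^sub>L 'h) \<Rightarrow> ('h \<Rightarrow> real) \<Rightarrow> ('h \<Rightarrow>\<^sub>L 'h) set \<Rightarrow> real \<Rightarrow>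
      ('h \<Rightarrow>\<^sub>L 'h) \<Rightarrow> bool" where
  "approx_unit J b h K \<epsilon> x \<longleftrightarrow>
     x \<in> J \<and> norm x \<le> 1 \<and> (\<forall>y\<in>K. norm ((x o\<^sub>L y) - y) \<le> \<epsilon>) \<and>
     (\<forall>\<xi>. \<bar>rinner (x (b \<xi>)) (b \<xi>) - h \<xi>\<bar> \<le> \<epsilon> * (norm \<xi>)\<^sup>2)"

lemma approx_unit_mono:
  "approx_unit J b h K \<epsilon> x \<Longrightarrow> K' \<subseteq> K \<Longrightarrow> \<epsilon> \<le> \<epsilon>' \<Longrightarrow> approx_unit J b h K' \<epsilon>' x"
  unfolding approx_unit_def by (meson mult_right_mono order_trans subsetD zero_le_power2)

lemma norm_convex_combination:
  assumes "norm x \<le> r" "norm y \<le> r" and uv: "0 \<le> u" "0 \<le> v" "u + v = 1"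
  shows "norm (u *\<^sub>R x + v *\<^sub>R y) \<le> r"
proof -
  have "norm (u *\<^sub>R x + v *\<^sub>R y) \<le> u * norm x + v * norm y"
    using norm_triangle_ineq[of "u *\<^sub>R x" "v *\<^sub>R y"] uv by simp
  also have "\<dots> \<le> u * r + v * r" using assms by (intro add_mono mult_left_mono) auto
  finally show ?thesis using uv(3) by (simp flip: distrib_right)
qed

lemma norm_apply_le_Suc: "norm (b \<xi>) \<le> (norm b + 1) * norm \<xi>"
  for b :: "'a::real_normed_vector \<Rightarrow>\<^sub>L 'b::real_normed_vector"
  using norm_blinfun[of b \<xi>] by (simp add: distrib_right add_increasing2)

lemma right_idealD:
  assumes "right_ideal A J"
  shows "J \<subseteq> A" "0 \<in> J" "x \<in> J \<Longrightarrow> y \<in> J \<Longrightarrow> x + y \<in> J" "x \<in> J \<Longrightarrow> scaleC_op c x \<in> J"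
    "x \<in> J \<Longrightarrow> a \<in> A \<Longrightarrow> x o\<^sub>L a \<in> J" "closed J"
    "x \<in> J \<Longrightarrow> r *\<^sub>R x \<in> J" "x \<in> J \<Longrightarrow> y \<in> J \<Longrightarrow> x - y \<in> J"
proof -
  show J: "J \<subseteq> A" "0 \<in> J" "x \<in> J \<Longrightarrow> y \<in> J \<Longrightarrow> x + y \<in> J" "x \<in> J \<Longrightarrow> scaleC_op c x \<in> J"
    "x \<in> J \<Longrightarrow> a \<in> A \<Longrightarrow> x o\<^sub>L a \<in> J" "closed J" for x y c a
    using assms unfolding right_ideal_def by blast+
  show scaleR: "x \<in> J \<Longrightarrow> r *\<^sub>R x \<in> J" for x r using J(4) by (simp add: scaleR_eq_scaleC_op)
  show "x \<in> J \<Longrightarrow> y \<in> J \<Longrightarrow> x - y \<in> J"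
    using J(3)[of x "(-1) *\<^sub>R y"] scaleR[of y "-1"] by simp
qed

text \<open>Mazur's theorem is applied to the image of a convex set \<open>T\<close> under x -> c x
  b, so that the x found keeps the demands collected in \<open>T\<close>. Norm closeness of c x b to
  \<open>m\<close> controls the form uniformly in \<xi>; then \<open>c\<close> is removed twice,
  from x and from the limit. \<open>h\<close> is read off from the weak* limit and depends on none
  of c, K, \<epsilon>.\<close>

lemma exists_approx_unit:
  fixes A :: "('h::complex_hilbert \<Rightarrow>\<^sub>L 'h) set"
  assumes A: "operator_algebra A" and hered: "hereditary_in_bidual A"
    and J: "right_ideal A J" and cai: "has_left_cai J" and b: "b \<in> A"
  obtains h where "\<And>\<xi>. \<bar>h \<xi>\<bar> \<le> ((norm b + 1) * norm \<xi>)\<^sup>2"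
    and "\<And>K \<epsilon>. finite K \<Longrightarrow> K \<subseteq> J \<Longrightarrow> 0 < \<epsilon> \<Longrightarrow> \<exists>x. approx_unit J b h K \<epsilon> x"
proof -
  note JD = right_idealD[OF J]
  obtain F where F: "F \<noteq> bot" "\<forall>\<^sub>F e in F. e \<in> J \<and> norm e \<le> 1"
    and Flim: "\<And>x. x \<in> J \<Longrightarrow> ((\<lambda>e. e o\<^sub>L x) \<longlongrightarrow> x) F"
    using cai unfolding has_left_cai_def by blast
  obtain C where C: "C \<noteq> bot" "\<forall>\<^sub>F c in C. c \<in> A \<and> norm c \<le> 1"
    and Clim: "\<And>x. x \<in> A \<Longrightarrow> ((\<lambda>c. c o\<^sub>L x) \<longlongrightarrow> x) C"
    using hered unfolding hereditary_in_bidual_def has_cai_def by blast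
  have "\<forall>\<^sub>F e in F. e \<in> A \<and> norm e \<le> 1"
    using F(2) JD(1) by (auto elim: eventually_mono)
  then obtain \<phi> G where \<phi>: "\<phi> \<in> bidual A" and G: "G \<le> F" "G \<noteq> bot"
    and lim: "\<And>f. f \<in> dual A \<Longrightarrow> ((\<lambda>x. f x) \<longlongrightarrow> \<phi> f) G"
    using weak_star_cluster_point[OF A F(1), of "\<lambda>x. x"] by blast
  have GJ: "\<forall>\<^sub>F x in G. x \<in> J \<and> norm x \<le> 1" using F(2) G(1) by (rule filter_leD[rotated])
  then have GA: "\<forall>\<^sub>F x in G. x \<in> A" using JD(1) by (auto elim: eventually_mono)
  define B where "B = norm b + 1"
  have B: "1 \<le> B" "norm (b \<xi>) \<le> B * norm \<xi>" for \<xi>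
    using norm_apply_le_Suc[of b] by (auto simp: B_def)
  define h where "h \<xi> = Re (\<phi> (\<lambda>x. if x \<in> A then cinner (x (b \<xi>)) (b \<xi>) else 0))" for \<xi>
  have hlim: "((\<lambda>x::'h \<Rightarrow>\<^sub>L 'h. rinner (x (b \<xi>)) (b \<xi>)) \<longlongrightarrow> h \<xi>) G" for \<xi>
  proof -
    have "((\<lambda>x. Re (if x \<in> A then cinner (x (b \<xi>)) (b \<xi>) else 0)) \<longlongrightarrow> h \<xi>) G"
      unfolding h_def by (intro tendsto_Re lim vector_functional_in_dual A)
    moreover have "\<forall>\<^sub>F x in G. Re (if x \<in> A then cinner (x (b \<xi>)) (b \<xi>) else 0) = rinner (x (b \<xi>)) (b \<xi>)"
      using GA by eventually_elim (simp add: rinner_def)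
    ultimately show ?thesis using Lim_transform_eventually by fast
  qed
  have ball: "norm (x (b \<xi>)) \<le> B * norm \<xi>" if "norm x \<le> 1" for x :: "'h \<Rightarrow>\<^sub>L 'h" and \<xi>
    using contraction_apply[OF that] B(2) order_trans by blast
  have hbound: "\<bar>h \<xi>\<bar> \<le> (B * norm \<xi>)\<^sup>2" for \<xi>
  proof (rule tendsto_upperbound[OF tendsto_rabs[OF hlim] _ G(2)])
    show "\<forall>\<^sub>F x in G. \<bar>rinner (blinfun_apply x (b \<xi>)) (b \<xi>)\<bar> \<le> (B * norm \<xi>)\<^sup>2"
      using GJ
    proof eventually_elim
      case (elim x)
      have "\<bar>rinner (x (b \<xi>)) (b \<xi>)\<bar> \<le> norm (x (b \<xi>)) * norm (b \<xi>)" by (rule rinner_Cauchy_Schwarz)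
      also have "\<dots> \<le> (B * norm \<xi>) * (B * norm \<xi>)"
        using elim ball B by (intro mult_mono) auto
      finally show ?case by (simp add: power2_eq_square)
    qed
  qed
  have "\<exists>x. approx_unit J b h K \<epsilon> x" if K: "finite K" "K \<subseteq> J" and \<epsilon>: "0 < \<epsilon>" for K \<epsilon>
  proof -
    \<comment> \<open>Removing \<open>c\<close> costs 3 s B^2 twice, which the 12 keeps below
      \<epsilon> / 2. The other half is Mazur's \<epsilon> / (2 B) times the factor B from norm (b
      \<xi>) \<le> B norm \<xi>.\<close>
    define s where "s = min 1 (\<epsilon> / (12 * B\<^sup>2))"
    have s: "0 < s" "s \<le> 1" using \<epsilon> B(1) by (auto simp: s_def)
    have "s * (12 * B\<^sup>2) \<le> \<epsilon>"
    proof -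
      have "s \<le> \<epsilon> / (12 * B\<^sup>2)" by (simp add: s_def)
      then show ?thesis using B(1) by (simp add: pos_le_divide_eq)
    qed
    then have s6: "6 * s * B\<^sup>2 \<le> \<epsilon> / 2" by simp
    have "\<forall>\<^sub>F c in C. dist (c o\<^sub>L b) b < s\<^sup>2 * B"
      using Clim[OF b] s B(1) by (intro tendstoD) auto
    then have "\<forall>\<^sub>F c in C. dist (c o\<^sub>L b) b < s\<^sup>2 * B \<and> c \<in> A \<and> norm c \<le> 1"
      using C(2) by eventually_elim simp
    then obtain c where c: "dist (c o\<^sub>L b) b < s\<^sup>2 * B" "c \<in> A" "norm c \<le> 1"
      using eventually_happens'[OF C(1)] by blast
    obtain m where m: "m \<in> A" and mlim: "\<And>f. f \<in> dual A \<Longrightarrow> ((\<lambda>x. f (c o\<^sub>L x o\<^sub>L b)) \<longlongrightarrow> f m) G"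
      using weak_limit_sandwich[OF A hered c(2) b \<phi> GA lim] by blast
    define T where "T = {x \<in> J. norm x \<le> 1 \<and> (\<forall>y\<in>K. norm ((x o\<^sub>L y) - y) \<le> \<epsilon>)}"
    have "\<forall>\<^sub>F x in G. \<forall>y\<in>K. dist (x o\<^sub>L y) y < \<epsilon>"
    proof (intro eventually_ball_finite K(1) ballI)
      fix y assume "y \<in> K"
      then show "\<forall>\<^sub>F x in G. dist (x o\<^sub>L y) y < \<epsilon>"
        using filter_leD[OF G(1)] tendstoD[OF Flim \<epsilon>] K(2) by blast
    qed
    then have GT: "\<forall>\<^sub>F x in G. x \<in> T"
      using GJ by eventually_elim (auto simp: T_def dist_norm intro: less_imp_le)
    have convT: "convex T"
    proof (rule convexI)
      fix x y and u v :: real assume xy: "x \<in> T" "y \<in> T" and uv: "0 \<le> u" "0 \<le> v" "u + v = 1"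
      note conv = norm_convex_combination[OF _ _ uv]
      have "((u *\<^sub>R x + v *\<^sub>R y) o\<^sub>L z) - z = u *\<^sub>R ((x o\<^sub>L z) - z) + v *\<^sub>R ((y o\<^sub>L z) - z)"
        for z :: "'h \<Rightarrow>\<^sub>L 'h"
      proof -
        have "u *\<^sub>R ((x o\<^sub>L z) - z) + v *\<^sub>R ((y o\<^sub>L z) - z) =
            (u *\<^sub>R (x o\<^sub>L z) + v *\<^sub>R (y o\<^sub>L z)) - (u *\<^sub>R z + v *\<^sub>R z)"
          by (simp add: scaleR_diff_right)
        also have "u *\<^sub>R z + v *\<^sub>R z = z" using uv(3) by (simp flip: scaleR_add_left)
        finally show ?thesis
          by (simp add: compose_add_left bounded_bilinear.scaleR_left[OF bounded_bilinear_blinfun_compose])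
      qed
      then show "u *\<^sub>R x + v *\<^sub>R y \<in> T"
        using xy by (auto simp: T_def conv intro!: JD(3) JD(7))
    qed
    have "linear (\<lambda>x. c o\<^sub>L x o\<^sub>L b)"
      by (intro linearI) (simp_all add: compose_add_left compose_add_right
          bounded_bilinear.scaleR_left[OF bounded_bilinear_blinfun_compose]
          bounded_bilinear.scaleR_right[OF bounded_bilinear_blinfun_compose])
    then have "convex ((\<lambda>x. c o\<^sub>L x o\<^sub>L b) ` T)" using convT by (rule convex_linear_image)
    moreover have "(\<lambda>x. c o\<^sub>L x o\<^sub>L b) ` T \<subseteq> A"
      using JD(1) b c by (auto simp: T_def intro!: alg_compose[OF A])
    moreover have "\<forall>\<^sub>F x in G. c o\<^sub>L x o\<^sub>L b \<in> (\<lambda>x. c o\<^sub>L x o\<^sub>L b) ` T"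
      using GT by eventually_elim simp
    moreover have "0 < \<epsilon> / (2 * B)" using \<epsilon> B(1) by simp
    ultimately obtain x where x: "x \<in> T" "norm ((c o\<^sub>L x o\<^sub>L b) - m) < \<epsilon> / (2 * B)"
      using weak_limit_approximation[OF A G(2), where X = "\<lambda>x. c o\<^sub>L x o\<^sub>L b" and m = m] m mlim by blast
    have "\<bar>rinner (x (b \<xi>)) (b \<xi>) - h \<xi>\<bar> \<le> \<epsilon> * (norm \<xi>)\<^sup>2" for \<xi>
    proof -
      let ?v = "b \<xi>"
      have near: "\<bar>rinner (c (y ?v)) ?v - rinner (y ?v) ?v\<bar> \<le> 3 * s * (B * norm \<xi>)\<^sup>2"
        if y: "norm y \<le> 1" for y :: "'h \<Rightarrow>\<^sub>L 'h"
      proof -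
        have "norm (c ?v - ?v) = norm (((c o\<^sub>L b) - b) \<xi>)" by (simp add: blinfun.diff_left)
        also have "\<dots> \<le> norm ((c o\<^sub>L b) - b) * norm \<xi>" by (rule norm_blinfun)
        also have "\<dots> \<le> (s\<^sup>2 * B) * norm \<xi>"
          using c(1) by (intro mult_right_mono) (auto simp: dist_norm)
        finally have "norm (c ?v - ?v) \<le> s\<^sup>2 * (B * norm \<xi>)" by (simp add: mult.assoc)
        then show ?thesis
          using contraction_almost_fixing[OF c(3) ball[OF y] B(2) _ s] by (simp add: rinner.diff_left)
      qed
      have 1: "\<bar>rinner (c (x ?v)) ?v - rinner (x ?v) ?v\<bar> \<le> 3 * s * (B * norm \<xi>)\<^sup>2"
        using x(1) by (intro near) (simp add: T_def)
      have "\<bar>rinner (((c o\<^sub>L x o\<^sub>L b) - m) \<xi>) ?v\<bar> \<le> norm (((c o\<^sub>L x o\<^sub>L b) - m) \<xi>) * norm ?v"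
        by (rule rinner_Cauchy_Schwarz)
      also have "\<dots> \<le> (\<epsilon> / (2 * B) * norm \<xi>) * (B * norm \<xi>)"
      proof (rule mult_mono)
        show "norm (((c o\<^sub>L x o\<^sub>L b) - m) \<xi>) \<le> \<epsilon> / (2 * B) * norm \<xi>"
          by (rule order_trans[OF norm_blinfun mult_right_mono[OF less_imp_le[OF x(2)] norm_ge_zero]])
      qed (use B \<epsilon> in auto)
      also have "\<dots> = \<epsilon> / 2 * (norm \<xi>)\<^sup>2" using B(1) by (simp add: field_simps power2_eq_square)
      finally have 2: "\<bar>rinner (c (x ?v)) ?v - rinner (m \<xi>) ?v\<bar> \<le> \<epsilon> / 2 * (norm \<xi>)\<^sup>2"
        by (simp add: blinfun.diff_left rinner.diff_left)
      \<comment> \<open>The estimate \<open>near\<close> holds eventually along \<open>G\<close> and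
        passes to the limit, where c y b tends weakly to \<open>m\<close> and the form of y tends to
        \<open>h\<close>.\<close>
      have 3: "\<bar>rinner (m \<xi>) ?v - h \<xi>\<bar> \<le> 3 * s * (B * norm \<xi>)\<^sup>2"
      proof (rule tendsto_upperbound[OF _ _ G(2)])
        let ?f = "\<lambda>x. if x \<in> A then cinner (x \<xi>) ?v else 0"
        have "((\<lambda>y. Re (?f (c o\<^sub>L y o\<^sub>L b))) \<longlongrightarrow> Re (?f m)) G"
          by (intro tendsto_Re mlim vector_functional_in_dual A)
        moreover have "\<forall>\<^sub>F y in G. Re (?f (c o\<^sub>L y o\<^sub>L b)) = rinner (c (y ?v)) ?v"
          using GA by eventually_elim (use b c in \<open>simp add: alg_compose[OF A] rinner_def\<close>)
        ultimately have "((\<lambda>y::'h \<Rightarrow>\<^sub>L 'h. rinner (c (y ?v)) ?v) \<longlongrightarrow> Re (?f m)) G"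
          using Lim_transform_eventually by fast
        then have "((\<lambda>y::'h \<Rightarrow>\<^sub>L 'h. rinner (c (y ?v)) ?v) \<longlongrightarrow> rinner (m \<xi>) ?v) G"
          using m by (simp add: rinner_def)
        then show "((\<lambda>y::'h \<Rightarrow>\<^sub>L 'h. \<bar>rinner (c (y ?v)) ?v - rinner (y ?v) ?v\<bar>) \<longlongrightarrow> \<bar>rinner (m \<xi>) ?v - h \<xi>\<bar>) G"
          by (intro tendsto_rabs tendsto_diff hlim)
        show "\<forall>\<^sub>F y in G. \<bar>rinner (c (blinfun_apply y ?v)) ?v - rinner (y ?v) ?v\<bar> \<le> 3 * s * (B * norm \<xi>)\<^sup>2"
          using GJ by eventually_elim (simp add: near)
      qed
      have "6 * s * (B * norm \<xi>)\<^sup>2 = (6 * s * B\<^sup>2) * (norm \<xi>)\<^sup>2"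
        by (simp add: power_mult_distrib mult.assoc)
      also have "\<dots> \<le> \<epsilon> / 2 * (norm \<xi>)\<^sup>2" using s6 by (intro mult_right_mono) auto
      finally show ?thesis using 1 2 3 by linarith
    qed
    then show ?thesis using x(1) by (auto simp: approx_unit_def T_def)
  qed
  then show ?thesis using that[of h] hbound by (auto simp: B_def)
qed

section \<open>Averaged units and the norm limit of \<open>x b\<close>\<close>

context
  fixes A J :: "('h::complex_hilbert \<Rightarrow>\<^sub>L 'h) set" and b :: "'h \<Rightarrow>\<^sub>L 'h" and h :: "'h \<Rightarrow> real"
  assumes J: "right_ideal A J" and b: "b \<in> A"
    and hbound: "\<And>\<xi>. \<bar>h \<xi>\<bar> \<le> ((norm b + 1) * norm \<xi>)\<^sup>2"
    and units: "\<And>K \<epsilon>. finite K \<Longrightarrow> K \<subseteq> J \<Longrightarrow> 0 < \<epsilon> \<Longrightarrow> \<exists>x. approx_unit J b h K \<epsilon> x"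
begin

text \<open>If every \<open>e\<^sub>i\<close> almost fixes its predecessors, the mixed terms \<open>\<langle>e\<^sub>i v, e\<^sub>j v\<rangle>\<close> are close to \<open>h\<close>, so
  the average \<open>E\<close> of \<open>n\<close> of them satisfies \<open>\<parallel>E v\<parallel>\<^sup>2 \<le> (1 - 1/n) h + \<parallel>v\<parallel>\<^sup>2/n\<close> up to a small error.\<close>

lemma averaged_approx_unit:
  assumes K: "finite K" "K \<subseteq> J" and \<eta>: "0 < \<eta>" and s: "0 < s" "s \<le> 1"
    and \<kappa>: "\<eta> + 3 * s * (norm b + 1)\<^sup>2 \<le> \<kappa>"
  shows "\<exists>E. approx_unit J b h K \<eta> E \<and>
    (\<forall>\<xi>. (norm (E (b \<xi>)))\<^sup>2 \<le>
       (1 - 1 / real (Suc n)) * h \<xi> + ((norm b + 1) * norm \<xi>)\<^sup>2 / real (Suc n) + \<kappa> * (norm \<xi>)\<^sup>2)"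
proof (induction n)
  case 0
  obtain e where e: "approx_unit J b h K \<eta> e" using units[OF K \<eta>] by blast
  have "0 \<le> \<kappa>" using \<kappa> \<eta> s by (smt (verit) mult_nonneg_nonneg zero_le_power2)
  have "(norm (e (b \<xi>)))\<^sup>2 \<le> ((norm b + 1) * norm \<xi>)\<^sup>2" for \<xi>
    using e contraction_apply[of e "b \<xi>"] norm_apply_le_Suc[of b \<xi>]
    by (intro power_mono) (auto simp: approx_unit_def)
  then have "(norm (e (b \<xi>)))\<^sup>2 \<le> ((norm b + 1) * norm \<xi>)\<^sup>2 + \<kappa> * (norm \<xi>)\<^sup>2" for \<xi>
    using \<open>0 \<le> \<kappa>\<close> by (simp add: add_increasing2)
  then show ?case using e by (auto intro!: exI[of _ e])
next
  case (Suc n)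
  note JD = right_idealD[OF J]
  obtain E where E: "approx_unit J b h K \<eta> E"
    and Eq: "\<And>\<xi>. (norm (E (b \<xi>)))\<^sup>2 \<le>
       (1 - 1 / real (Suc n)) * h \<xi> + ((norm b + 1) * norm \<xi>)\<^sup>2 / real (Suc n) + \<kappa> * (norm \<xi>)\<^sup>2"
    using Suc.IH by blast
  have EJ: "E \<in> J" "norm E \<le> 1" using E by (auto simp: approx_unit_def)
  \<comment> \<open>The new unit has to fix the old average up to s^2: then its adjoint almost fixes
    E v, and <E v, e v> is near <E v, v>, hence near \<open>h\<close>.\<close>
  obtain e where e': "approx_unit J b h (insert E K) (min \<eta> (s\<^sup>2)) e"
    using units[of "insert E K" "min \<eta> (s\<^sup>2)"] K EJ \<eta> s by auto
  then have e: "approx_unit J b h K \<eta> e" by (rule approx_unit_mono) auto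
  have eJ: "e \<in> J" "norm e \<le> 1" "norm ((e o\<^sub>L E) - E) \<le> s\<^sup>2" using e' by (auto simp: approx_unit_def)
  \<comment> \<open>\<open>E\<close> plays the mean of \<open>Suc n\<close> units; the weights below
    make \<open>E'\<close> the mean of one more.\<close>
  define p :: real where "p = Suc n"
  have p: "0 < p" by (simp add: p_def)
  define \<alpha> \<beta> where "\<alpha> = p / (p + 1)" and "\<beta> = 1 / (p + 1)"
  have \<alpha>\<beta>: "0 \<le> \<alpha>" "0 \<le> \<beta>" "\<alpha> + \<beta> = 1" using p by (auto simp: \<alpha>_def \<beta>_def field_simps)
  define E' where "E' = \<alpha> *\<^sub>R E + \<beta> *\<^sub>R e"
  note conv = norm_convex_combination[OF _ _ \<alpha>\<beta>]
  have split: "z = \<alpha> *\<^sub>R z + \<beta> *\<^sub>R z" for z :: "'a::real_vector"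
    using \<alpha>\<beta>(3) by (simp flip: scaleR_add_left)
  have "approx_unit J b h K \<eta> E'"
    unfolding approx_unit_def
  proof (intro conjI ballI allI)
    show "E' \<in> J" unfolding E'_def by (intro JD(3) JD(7) EJ eJ)
    show "norm E' \<le> 1" unfolding E'_def by (intro conv EJ eJ)
    show "norm ((E' o\<^sub>L y) - y) \<le> \<eta>" if "y \<in> K" for y
    proof -
      have "(E' o\<^sub>L y) - y = \<alpha> *\<^sub>R ((E o\<^sub>L y) - y) + \<beta> *\<^sub>R ((e o\<^sub>L y) - y)"
        by (subst (2) split)
          (simp add: E'_def compose_add_left scaleR_diff_right
            bounded_bilinear.scaleR_left[OF bounded_bilinear_blinfun_compose])
      then show ?thesis using E e that by (auto simp: approx_unit_def intro!: conv)
    qed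
    show "\<bar>rinner (E' (b \<xi>)) (b \<xi>) - h \<xi>\<bar> \<le> \<eta> * (norm \<xi>)\<^sup>2" for \<xi>
    proof -
      have "rinner (E' (b \<xi>)) (b \<xi>) - h \<xi> =
          \<alpha> *\<^sub>R (rinner (E (b \<xi>)) (b \<xi>) - h \<xi>) + \<beta> *\<^sub>R (rinner (e (b \<xi>)) (b \<xi>) - h \<xi>)"
        by (subst split[of "h \<xi>"])
          (simp add: E'_def blinfun.add_left blinfun.scaleR_left rinner.add_left rinner.scaleR_left
            right_diff_distrib)
      then show ?thesis
        using E e conv[of "rinner (E (b \<xi>)) (b \<xi>) - h \<xi>" "\<eta> * (norm \<xi>)\<^sup>2"
            "rinner (e (b \<xi>)) (b \<xi>) - h \<xi>"]
        by (auto simp: approx_unit_def)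
    qed
  qed
  moreover have "(norm (E' (b \<xi>)))\<^sup>2 \<le>
       (1 - 1 / real (Suc (Suc n))) * h \<xi> + ((norm b + 1) * norm \<xi>)\<^sup>2 / real (Suc (Suc n)) + \<kappa> * (norm \<xi>)\<^sup>2" for \<xi>
  proof -
    define v where "v = b \<xi>"
    define V where "V = ((norm b + 1) * norm \<xi>)\<^sup>2"
    define k where "k = \<kappa> * (norm \<xi>)\<^sup>2"
    have v: "norm v \<le> (norm b + 1) * norm \<xi>" unfolding v_def by (rule norm_apply_le_Suc)
    then have Ev: "norm (E v) \<le> (norm b + 1) * norm \<xi>" "norm (e v) \<le> (norm b + 1) * norm \<xi>"
      using contraction_apply[OF EJ(2), of v] contraction_apply[OF eJ(2), of v] by auto
    have 1: "(norm (E v))\<^sup>2 \<le> (1 - 1 / p) * h \<xi> + V / p + k"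
      using Eq[of \<xi>] by (simp add: v_def V_def k_def p_def)
    have 2: "(norm (e v))\<^sup>2 \<le> V" unfolding V_def using Ev(2) by (intro power_mono) auto
    have 3: "rinner (E v) (e v) \<le> h \<xi> + k"
    proof -
      have "norm (e (E v) - E v) = norm (((e o\<^sub>L E) - E) v)" by (simp add: blinfun.diff_left)
      also have "\<dots> \<le> norm ((e o\<^sub>L E) - E) * norm v" by (rule norm_blinfun)
      also have "\<dots> \<le> s\<^sup>2 * ((norm b + 1) * norm \<xi>)" using eJ(3) v by (intro mult_mono) auto
      finally have "\<bar>rinner (e v - v) (E v)\<bar> \<le> 3 * s * V"
        unfolding V_def by (rule contraction_almost_fixing[OF eJ(2) v Ev(1) _ s])
      moreover have "\<bar>rinner (E v) v - h \<xi>\<bar> \<le> \<eta> * (norm \<xi>)\<^sup>2"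
        using E by (simp add: approx_unit_def v_def)
      moreover have "\<eta> * (norm \<xi>)\<^sup>2 + 3 * s * V \<le> k"
      proof -
        have "(\<eta> + 3 * s * (norm b + 1)\<^sup>2) * (norm \<xi>)\<^sup>2 \<le> k"
          unfolding k_def using \<kappa> by (rule mult_right_mono) simp
        then show ?thesis unfolding V_def power_mult_distrib by (simp add: distrib_right mult.assoc)
      qed
      ultimately show ?thesis
        by (simp add: rinner.diff_left rinner_commute[of "E v"])
    qed
    have k: "0 \<le> k"
      unfolding k_def using \<kappa> \<eta> s by (smt (verit) mult_nonneg_nonneg zero_le_power2)
    have "(p + 1) *\<^sub>R E' v = p *\<^sub>R E v + e v"
      using p by (simp add: E'_def \<alpha>_def \<beta>_def blinfun.add_left blinfun.scaleR_left scaleR_add_right)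
    then have "(norm ((p + 1) *\<^sub>R E' v))\<^sup>2 = (norm (p *\<^sub>R E v + e v))\<^sup>2" by simp
    then have "(p + 1)\<^sup>2 * (norm (E' v))\<^sup>2 =
        p\<^sup>2 * (norm (E v))\<^sup>2 + 2 * p * rinner (E v) (e v) + (norm (e v))\<^sup>2"
      by (simp add: norm_add_sq power_mult_distrib rinner.scaleR_left)
    also have "\<dots> \<le> p\<^sup>2 * ((1 - 1 / p) * h \<xi> + V / p + k) + 2 * p * (h \<xi> + k) + V"
      using 1 2 3 p by (intro add_mono mult_left_mono) auto
    also have "\<dots> = (p\<^sup>2 + p) * h \<xi> + (p + 1) * V + (p\<^sup>2 + 2 * p) * k"
      using p by (simp add: field_simps power2_eq_square)
    \<comment> \<open>The error does not accumulate: p^2 + 2 p \<le> (p + 1)^2, so the same \<kappa>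
      survives the induction.\<close>
    also have "\<dots> \<le> (p\<^sup>2 + p) * h \<xi> + (p + 1) * V + (p + 1)\<^sup>2 * k"
      using k by (intro add_left_mono mult_right_mono) (auto simp: power2_eq_square algebra_simps)
    also have "\<dots> = (p + 1)\<^sup>2 * ((1 - 1 / (p + 1)) * h \<xi> + V / (p + 1) + k)"
    proof -
      have "(p + 1)\<^sup>2 * (1 - 1 / (p + 1)) = p\<^sup>2 + p" "(p + 1)\<^sup>2 / (p + 1) = p + 1"
        using p by (simp_all add: field_simps power2_eq_square)
      moreover have "(p + 1)\<^sup>2 * ((1 - 1 / (p + 1)) * h \<xi> + V / (p + 1) + k) =
          ((p + 1)\<^sup>2 * (1 - 1 / (p + 1))) * h \<xi> + ((p + 1)\<^sup>2 / (p + 1)) * V + (p + 1)\<^sup>2 * k"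
        by (simp only: distrib_left mult.assoc times_divide_eq_left times_divide_eq_right)
      ultimately show ?thesis by (simp only:)
    qed
    finally have "(norm (E' v))\<^sup>2 \<le> (1 - 1 / (p + 1)) * h \<xi> + V / (p + 1) + k"
      using p by (simp add: mult_le_cancel_left_pos)
    then show ?thesis by (simp add: v_def V_def k_def p_def add.commute)
  qed
  ultimately show ?case by blast
qed

text \<open>For the projection, norm (p v) ^ 2 equals <p v, v>. The second clause imposes the upper
  half of this on x, the half that bounds the expansion of norm (z v - x v) ^ 2.\<close>

definition good :: "real \<Rightarrow> ('h \<Rightarrow>\<^sub>L 'h) set \<Rightarrow> ('h \<Rightarrow>\<^sub>L 'h) \<Rightarrow> bool" where
  "good \<epsilon> K x \<longleftrightarrow> approx_unit J b h K \<epsilon> x \<and>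
     (\<forall>\<xi>. (norm (x (b \<xi>)))\<^sup>2 \<le> h \<xi> + \<epsilon> * (norm \<xi>)\<^sup>2)"

lemma good_mono: "good \<epsilon> K x \<Longrightarrow> K' \<subseteq> K \<Longrightarrow> \<epsilon> \<le> \<epsilon>' \<Longrightarrow> good \<epsilon>' K' x"
  unfolding good_def using approx_unit_mono
  by (meson add_left_mono mult_right_mono order_trans zero_le_power2)

lemma exists_good:
  assumes K: "finite K" "K \<subseteq> J" and \<epsilon>: "0 < \<epsilon>"
  shows "\<exists>x. good \<epsilon> K x"
proof -
  define B where "B = norm b + 1"
  have B: "1 \<le> B" by (simp add: B_def)
  define s where "s = min 1 (\<epsilon> / (12 * B\<^sup>2))"
  have s: "0 < s" "s \<le> 1" using \<epsilon> B by (auto simp: s_def)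
  have "s \<le> \<epsilon> / (12 * B\<^sup>2)" by (simp add: s_def)
  then have "s * (12 * B\<^sup>2) \<le> \<epsilon>" using B by (simp add: pos_le_divide_eq)
  then have \<kappa>: "\<epsilon> / 4 + 3 * s * (norm b + 1)\<^sup>2 \<le> \<epsilon> / 2" by (simp flip: B_def)
  \<comment> \<open>Averaging leaves -h / (n + 1) and (B norm \<xi>)^2 / (n + 1). By
    \<open>hbound\<close> the first is at most the second, and this n puts their sum below
    \<epsilon> / 2 times norm \<xi> ^ 2.\<close>
  obtain n :: nat where n: "4 * B\<^sup>2 / \<epsilon> < real (Suc n)"
    by (meson less_Suc_eq of_nat_less_iff order_less_trans reals_Archimedean2)
  obtain E where E: "approx_unit J b h K (\<epsilon> / 4) E"
    and Eq: "\<And>\<xi>. (norm (E (b \<xi>)))\<^sup>2 \<le>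
       (1 - 1 / real (Suc n)) * h \<xi> + (B * norm \<xi>)\<^sup>2 / real (Suc n) + \<epsilon> / 2 * (norm \<xi>)\<^sup>2"
    using averaged_approx_unit[OF K _ s \<kappa>, of n] \<epsilon> unfolding B_def by auto
  have "(norm (E (b \<xi>)))\<^sup>2 \<le> h \<xi> + \<epsilon> * (norm \<xi>)\<^sup>2" for \<xi>
  proof -
    have "- h \<xi> / real (Suc n) \<le> (B * norm \<xi>)\<^sup>2 / real (Suc n)"
      using hbound[of \<xi>] by (intro divide_right_mono) (auto simp: B_def)
    moreover have "(1 - 1 / real (Suc n)) * h \<xi> = h \<xi> + - h \<xi> / real (Suc n)" by (simp add: left_diff_distrib)
    ultimately have "(norm (E (b \<xi>)))\<^sup>2 \<le> h \<xi> + 2 * ((B * norm \<xi>)\<^sup>2 / real (Suc n)) + \<epsilon> / 2 * (norm \<xi>)\<^sup>2"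
      using Eq[of \<xi>] by argo
    moreover have "2 * ((B * norm \<xi>)\<^sup>2 / real (Suc n)) \<le> \<epsilon> / 2 * (norm \<xi>)\<^sup>2"
    proof -
      have "2 * (B\<^sup>2 / real (Suc n)) \<le> \<epsilon> / 2" using n \<epsilon> by (simp add: field_simps)
      then have "2 * (B\<^sup>2 / real (Suc n)) * (norm \<xi>)\<^sup>2 \<le> \<epsilon> / 2 * (norm \<xi>)\<^sup>2" by (rule mult_right_mono) simp
      then show ?thesis by (simp add: power_mult_distrib)
    qed
    ultimately show ?thesis by argo
  qed
  moreover have "approx_unit J b h K \<epsilon> E" using E by (rule approx_unit_mono) (use \<epsilon> in auto)
  ultimately show ?thesis unfolding good_def by blast
qed

text \<open>Both units are compared with a third one, z, that almost fixes them. In norm (z v - x v)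
  ^ 2 the cross term <z v, x v> is near <v, x v>, hence near \<open>h\<close>, and the three copies
  of \<open>h\<close> cancel. That \<epsilon> is independent of K and L makes sequences of units
  Cauchy on \<open>b\<close>.\<close>

lemma good_close:
  assumes \<tau>: "0 < \<tau>"
  obtains \<epsilon> where "0 < \<epsilon>" "\<And>x y K L. good \<epsilon> K x \<Longrightarrow> good \<epsilon> L y \<Longrightarrow> norm ((x o\<^sub>L b) - (y o\<^sub>L b)) \<le> \<tau>"
proof -
  define B where "B = norm b + 1"
  have B: "1 \<le> B" "norm (b \<xi>) \<le> B * norm \<xi>" for \<xi>
    using norm_apply_le_Suc[of b] by (auto simp: B_def)
  \<comment> \<open>Four errors s^2, one from each squared norm and two from the doubled form, and
    twice 3 s B^2 from the cross term; s^2 \<le> s combines them into D s.\<close>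
  define D where "D = 4 + 6 * B\<^sup>2"
  have D: "0 < D" unfolding D_def by (simp add: add_pos_nonneg)
  define s where "s = min 1 ((\<tau> / 2)\<^sup>2 / D)"
  have s: "0 < s" "s \<le> 1" using \<tau> D by (auto simp: s_def)
  have "s \<le> (\<tau> / 2)\<^sup>2 / D" by (simp add: s_def)
  then have sD: "D * s \<le> (\<tau> / 2)\<^sup>2" using D by (simp add: pos_le_divide_eq mult.commute)
  have half: "norm ((z o\<^sub>L b) - (x o\<^sub>L b)) \<le> \<tau> / 2"
    if x: "good (s\<^sup>2) K x" and z: "good (s\<^sup>2) L z" and "x \<in> L" for x z K L
  proof (rule norm_blinfun_bound)
    fix \<xi>
    let ?v = "b \<xi>"
    have zx: "norm z \<le> 1" "norm x \<le> 1" "norm ((z o\<^sub>L x) - x) \<le> s\<^sup>2"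
      using x z \<open>x \<in> L\<close> by (auto simp: good_def approx_unit_def)
    have "norm (z (x ?v) - x ?v) = norm (((z o\<^sub>L x) - x) ?v)" by (simp add: blinfun.diff_left)
    also have "\<dots> \<le> norm ((z o\<^sub>L x) - x) * norm ?v" by (rule norm_blinfun)
    also have "\<dots> \<le> s\<^sup>2 * (B * norm \<xi>)" using zx(3) B by (intro mult_mono) auto
    finally have "\<bar>rinner (z ?v - ?v) (x ?v)\<bar> \<le> 3 * s * (B * norm \<xi>)\<^sup>2"
      using contraction_apply[OF zx(2), of ?v] B(2)[of \<xi>]
      by (intro contraction_almost_fixing[OF zx(1) B(2) _ _ s]) auto
    moreover have "\<bar>rinner (x ?v) ?v - h \<xi>\<bar> \<le> s\<^sup>2 * (norm \<xi>)\<^sup>2"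
      using x by (simp add: good_def approx_unit_def)
    moreover have "(norm (x ?v))\<^sup>2 \<le> h \<xi> + s\<^sup>2 * (norm \<xi>)\<^sup>2" "(norm (z ?v))\<^sup>2 \<le> h \<xi> + s\<^sup>2 * (norm \<xi>)\<^sup>2"
      using x z by (auto simp: good_def)
    ultimately have "(norm (z ?v - x ?v))\<^sup>2 \<le> 4 * (s\<^sup>2 * (norm \<xi>)\<^sup>2) + 6 * s * (B * norm \<xi>)\<^sup>2"
      by (simp add: norm_diff_sq rinner.diff_left rinner_commute[of "x ?v"])
    also have "\<dots> \<le> 4 * (s * (norm \<xi>)\<^sup>2) + 6 * s * (B * norm \<xi>)\<^sup>2"
      using s by (intro add_right_mono mult_left_mono mult_right_mono) (auto simp: power2_eq_square mult_le_one)
    also have "\<dots> = D * s * (norm \<xi>)\<^sup>2" by (simp add: D_def power_mult_distrib algebra_simps)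
    also have "\<dots> \<le> (\<tau> / 2)\<^sup>2 * (norm \<xi>)\<^sup>2" using sD by (rule mult_right_mono) simp
    also have "\<dots> = (\<tau> / 2 * norm \<xi>)\<^sup>2" by (simp only: power_mult_distrib)
    finally show "norm (((z o\<^sub>L b) - (x o\<^sub>L b)) \<xi>) \<le> \<tau> / 2 * norm \<xi>"
      using \<tau> by (auto simp: blinfun.diff_left intro: power2_le_imp_le)
  qed (use \<tau> in simp)
  show ?thesis
  proof (rule that[of "s\<^sup>2"])
    fix x y K L assume xy: "good (s\<^sup>2) K x" "good (s\<^sup>2) L y"
    then have "x \<in> J" "y \<in> J" by (auto simp: good_def approx_unit_def)
    then obtain z where z: "good (s\<^sup>2) {x, y} z" using exists_good[of "{x, y}" "s\<^sup>2"] s by auto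
    have "norm ((x o\<^sub>L b) - (y o\<^sub>L b)) \<le> norm ((z o\<^sub>L b) - (x o\<^sub>L b)) + norm ((z o\<^sub>L b) - (y o\<^sub>L b))"
      using norm_triangle_ineq4[of "(z o\<^sub>L b) - (y o\<^sub>L b)" "(z o\<^sub>L b) - (x o\<^sub>L b)"] by simp
    also have "\<dots> \<le> \<tau> / 2 + \<tau> / 2" using half[OF xy(1) z] half[OF xy(2) z] by simp
    finally show "norm ((x o\<^sub>L b) - (y o\<^sub>L b)) \<le> \<tau>" by simp
  qed (use s in simp)
qed

text \<open>The element \<open>l\<close> is P b, the norm limit of \<open>E n o\<^sub>L b\<close>
  for increasingly good units; it stays in \<open>J\<close> because \<open>J\<close> is a closed
  right ideal.\<close>

lemma orthogonal_decomposition_of_units: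
  obtains l where "l \<in> J" "\<And>j \<xi> \<eta>. j \<in> J \<Longrightarrow> rinner (b \<xi> - l \<xi>) (j \<eta>) = 0"
proof -
  note JD = right_idealD[OF J]
  have "\<exists>x. good (1 / real (Suc n)) {} x" for n by (intro exists_good) auto
  then obtain E where E: "\<And>n. good (1 / real (Suc n)) {} (E n)" by metis
  have late: "\<exists>N. \<forall>n\<ge>N. good \<epsilon> {} (E n)" if \<epsilon>: "0 < \<epsilon>" for \<epsilon> :: real
  proof -
    obtain N where N: "1 / real (Suc N) < \<epsilon>" using nat_approx_posE[OF \<epsilon>] by blast
    have "1 / real (Suc n) \<le> \<epsilon>" if "N \<le> n" for n
    proof -
      have "1 / real (Suc n) \<le> 1 / real (Suc N)" using that by (intro divide_left_mono) auto
      then show ?thesis using N by simp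
    qed
    then show ?thesis using E good_mono by (meson order_refl)
  qed
  have "Cauchy (\<lambda>n. E n o\<^sub>L b)"
  proof (rule metric_CauchyI)
    fix e :: real assume e: "0 < e"
    obtain \<epsilon> where \<epsilon>: "0 < \<epsilon>"
      "\<And>x y K L. good \<epsilon> K x \<Longrightarrow> good \<epsilon> L y \<Longrightarrow> norm ((x o\<^sub>L b) - (y o\<^sub>L b)) \<le> e / 2"
      using good_close[of "e / 2"] e by (metis half_gt_zero)
    obtain N where "\<And>n. N \<le> n \<Longrightarrow> good \<epsilon> {} (E n)" using late[OF \<epsilon>(1)] by blast
    then have "dist (E m o\<^sub>L b) (E n o\<^sub>L b) \<le> e / 2" if "N \<le> m" "N \<le> n" for m n
      using \<epsilon>(2) that unfolding dist_norm by blast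
    then show "\<exists>M. \<forall>m\<ge>M. \<forall>n\<ge>M. dist (E m o\<^sub>L b) (E n o\<^sub>L b) < e"
      using e by (intro exI[of _ N]) force
  qed
  then obtain l where l: "(\<lambda>n. E n o\<^sub>L b) \<longlonglongrightarrow> l"
    using Cauchy_convergent_iff convergent_def by blast
  have "E n o\<^sub>L b \<in> J" for n using E[of n] b by (auto simp: good_def approx_unit_def intro: JD(5))
  then have "l \<in> J" by (rule closed_sequentially[OF JD(6) _ l])
  moreover have "rinner (b \<xi> - l \<xi>) (j \<eta>) = 0" if j: "j \<in> J" for j \<xi> \<eta>
  proof -
    define R where "R = (norm b + 1) * norm \<xi> + (norm j + 1) * norm \<eta>"
    have R: "norm (b \<xi>) \<le> R" "norm (j \<eta>) \<le> R" "norm \<eta> \<le> R"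
      using norm_apply_le_Suc[of b \<xi>] norm_apply_le_Suc[of j \<eta>]
      by (auto simp: R_def distrib_right add_increasing add_increasing2)
    have small: "\<bar>rinner (b \<xi> - l \<xi>) (j \<eta>)\<bar> \<le> s * (3 * R\<^sup>2 + 2 * norm \<xi> * R)" if s: "0 < s" "s \<le> 1" for s
    proof -
      obtain \<epsilon> where \<epsilon>: "0 < \<epsilon>"
        "\<And>x y K L. good \<epsilon> K x \<Longrightarrow> good \<epsilon> L y \<Longrightarrow> norm ((x o\<^sub>L b) - (y o\<^sub>L b)) \<le> s"
        using good_close[OF s(1)] by metis
      obtain N where N: "\<And>n. N \<le> n \<Longrightarrow> good \<epsilon> {} (E n)" using late[OF \<epsilon>(1)] by blast
      \<comment> \<open>The \<open>E n\<close> are not asked to fix anything. This x almost fixes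
        \<open>j\<close>, so b \<xi> - x (b \<xi>) is almost orthogonal to j \<eta>, and closeness
        of x b to \<open>E n o\<^sub>L b\<close> carries this over to \<open>l\<close>.\<close>
      obtain x where x: "good (min \<epsilon> (s\<^sup>2)) {j} x" using exists_good[of "{j}" "min \<epsilon> (s\<^sup>2)"] j \<epsilon> s by auto
      have xs: "norm x \<le> 1" "norm ((x o\<^sub>L j) - j) \<le> s\<^sup>2" using x by (auto simp: good_def approx_unit_def)
      have "norm (x (j \<eta>) - j \<eta>) = norm (((x o\<^sub>L j) - j) \<eta>)" by (simp add: blinfun.diff_left)
      also have "\<dots> \<le> norm ((x o\<^sub>L j) - j) * norm \<eta>" by (rule norm_blinfun)
      also have "\<dots> \<le> s\<^sup>2 * R" using xs(2) R by (intro mult_mono) auto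
      finally have 1: "\<bar>rinner (x (b \<xi>) - b \<xi>) (j \<eta>)\<bar> \<le> 3 * s * R\<^sup>2"
        by (rule contraction_almost_fixing[OF xs(1) R(1,2) _ s])
      have "\<forall>\<^sub>F n in sequentially. N \<le> n \<and> dist (E n o\<^sub>L b) l < s"
        by (intro eventually_conj eventually_ge_at_top tendstoD[OF l s(1)])
      then obtain n where n: "N \<le> n" "dist (E n o\<^sub>L b) l < s"
        using eventually_happens'[OF sequentially_bot] by blast
      have "good \<epsilon> {j} x" using x by (rule good_mono) auto
      then have "norm ((x o\<^sub>L b) - (E n o\<^sub>L b)) \<le> s" using \<epsilon>(2) N[OF n(1)] by blast
      then have "norm ((x o\<^sub>L b) - l) \<le> 2 * s"
        using n(2) norm_triangle_ineq[of "(x o\<^sub>L b) - (E n o\<^sub>L b)" "(E n o\<^sub>L b) - l"]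
        by (simp add: dist_norm)
      then have "norm (x (b \<xi>) - l \<xi>) \<le> 2 * s * norm \<xi>"
        using norm_blinfun[of "(x o\<^sub>L b) - l" \<xi>] mult_right_mono[OF _ norm_ge_zero[of \<xi>]]
        by (fastforce simp: blinfun.diff_left)
      then have 2: "\<bar>rinner (x (b \<xi>) - l \<xi>) (j \<eta>)\<bar> \<le> (2 * s * norm \<xi>) * R"
        using R s by (intro order_trans[OF rinner_Cauchy_Schwarz] mult_mono) auto
      have "rinner (b \<xi> - l \<xi>) (j \<eta>) = rinner (x (b \<xi>) - l \<xi>) (j \<eta>) - rinner (x (b \<xi>) - b \<xi>) (j \<eta>)"
        by (simp add: rinner.diff_left)
      then show ?thesis using 1 2 by (simp add: algebra_simps)
    qed
    have "((\<lambda>s. s * (3 * R\<^sup>2 + 2 * norm \<xi> * R)) \<longlongrightarrow> 0 * (3 * R\<^sup>2 + 2 * norm \<xi> * R)) (at_right 0)"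
      by (intro tendsto_intros)
    moreover have "\<forall>\<^sub>F s in at_right (0::real). \<bar>rinner (b \<xi> - l \<xi>) (j \<eta>)\<bar> \<le> s * (3 * R\<^sup>2 + 2 * norm \<xi> * R)"
      unfolding eventually_at_right_field using small by (intro exI[of _ 1]) auto
    ultimately have "\<bar>rinner (b \<xi> - l \<xi>) (j \<eta>)\<bar> \<le> 0 * (3 * R\<^sup>2 + 2 * norm \<xi> * R)"
      by (rule tendsto_lowerbound) simp
    then show ?thesis by simp
  qed
  ultimately show ?thesis by (rule that)
qed

end

lemma orthogonal_decomposition:
  fixes A :: "('h::complex_hilbert \<Rightarrow>\<^sub>L 'h) set"
  assumes "operator_algebra A" "hereditary_in_bidual A" "right_ideal A J" "has_left_cai J" "b \<in> A"
  shows "\<exists>l\<in>J. \<forall>j\<in>J. \<forall>\<xi> \<eta>. rinner (b \<xi> - l \<xi>) (j \<eta>) = 0"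
proof -
  obtain h where h: "\<And>\<xi>. \<bar>h \<xi>\<bar> \<le> ((norm b + 1) * norm \<xi>)\<^sup>2"
    and units: "\<And>K \<epsilon>. finite K \<Longrightarrow> K \<subseteq> J \<Longrightarrow> 0 < \<epsilon> \<Longrightarrow> \<exists>x. approx_unit J b h K \<epsilon> x"
    using exists_approx_unit[OF assms] by blast
  show ?thesis
  proof (rule orthogonal_decomposition_of_units[of A J b h])
    fix l assume "l \<in> J" "\<And>j \<xi> \<eta>. j \<in> J \<Longrightarrow> rinner (b \<xi> - l \<xi>) (j \<eta>) = 0"
    then show ?thesis by blast
  qed (fact assms(3,5) h units)+
qed

lemma norm_op_le:
  fixes X :: "'h::complex_hilbert \<Rightarrow>\<^sub>L 'h"
  assumes K: "0 \<le> K" and X: "\<And>\<xi> \<eta>. norm \<xi> = 1 \<Longrightarrow> norm \<eta> = 1 \<Longrightarrow> rinner (X \<xi>) \<eta> \<le> K"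
  shows "norm X \<le> K"
proof (rule norm_blinfun_bound[OF K])
  fix \<xi>
  show "norm (X \<xi>) \<le> K * norm \<xi>"
  proof (cases "\<xi> = 0 \<or> X \<xi> = 0")
    case True
    then show ?thesis using K by auto
  next
    case False
    have "rinner (X (inverse (norm \<xi>) *\<^sub>R \<xi>)) (inverse (norm (X \<xi>)) *\<^sub>R X \<xi>) \<le> K"
      using False by (intro X) auto
    then show ?thesis
      using False
      by (simp add: blinfun.scaleR_right rinner.scaleR_left rinner.scaleR_right rinner_self
          power2_eq_square field_simps)
  qed
qed

section \<open>The support projection as a multiplier\<close>

text \<open>The map \<open>L\<close> is left multiplication by the projection \<open>P\<close> onto the closed span of the ranges of \<open>J\<close>,
  and \<open>R\<close> is right multiplication by \<open>P\<close>; the projection in \<open>A\<^sup>*\<^sup>*\<close> is a weak* limit of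
  \<open>P c P = R (L c)\<close> with \<open>c\<close> running through the cai of \<open>A\<close>.\<close>

context
  fixes A J :: "('h::complex_hilbert \<Rightarrow>\<^sub>L 'h) set" and C :: "('h \<Rightarrow>\<^sub>L 'h) filter" and L
  assumes A: "operator_algebra A" and J: "right_ideal A J"
    and C: "C \<noteq> bot" "\<forall>\<^sub>F c in C. c \<in> A \<and> norm c \<le> 1"
    and C_left: "\<And>x. x \<in> A \<Longrightarrow> ((\<lambda>c. c o\<^sub>L x) \<longlongrightarrow> x) C"
    and C_right: "\<And>x. x \<in> A \<Longrightarrow> ((\<lambda>c. x o\<^sub>L c) \<longlongrightarrow> x) C"
    and L: "\<And>b. b \<in> A \<Longrightarrow> L b \<in> J"
    and orth: "\<And>b j \<xi> \<eta>. b \<in> A \<Longrightarrow> j \<in> J \<Longrightarrow> rinner (b \<xi> - L b \<xi>) (j \<eta>) = 0"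
begin

lemma J_subset: "x \<in> J \<Longrightarrow> x \<in> A"
  using right_idealD(1)[OF J] by blast

lemma L_alg: "b \<in> A \<Longrightarrow> L b \<in> A"
  using L J_subset by blast

text \<open>The difference L b - l lies in \<open>J\<close>, so its values are orthogonal to its own
  range. The algebraic rules for \<open>L\<close> below follow by checking that the right-hand side
  has the two defining properties.\<close>

lemma L_unique:
  assumes b: "b \<in> A" and l: "l \<in> J" "\<And>j \<xi> \<eta>. j \<in> J \<Longrightarrow> rinner (b \<xi> - l \<xi>) (j \<eta>) = 0"
  shows "L b = l"
proof (rule blinfun_eqI)
  fix \<xi>
  have d: "L b - l \<in> J" by (intro right_idealD(8)[OF J] L b l)
  have "rinner ((L b - l) \<xi>) ((L b - l) \<xi>) = 0"
    using l(2)[OF d, of \<xi> \<xi>] orth[OF b d, of \<xi> \<xi>] by (simp add: blinfun.diff_left rinner.diff_left)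
  then show "L b \<xi> = l \<xi>" by (simp add: rinner_self blinfun.diff_left)
qed

lemma L_fix: "j \<in> J \<Longrightarrow> L j = j"
  by (rule L_unique) (auto simp: J_subset rinner.zero_left)

lemma L_diff:
  assumes "a \<in> A" "b \<in> A"
  shows "L (a - b) = L a - L b"
proof (rule L_unique)
  fix j \<xi> \<eta> assume j: "j \<in> J"
  have "(a - b) \<xi> - (L a - L b) \<xi> = (a \<xi> - L a \<xi>) - (b \<xi> - L b \<xi>)" by (simp add: blinfun.diff_left)
  then show "rinner ((a - b) \<xi> - (L a - L b) \<xi>) (j \<eta>) = 0"
    using orth[OF assms(1) j] orth[OF assms(2) j] by (simp add: rinner.diff_left)
qed (use assms in \<open>auto intro: alg_diff[OF A] right_idealD(8)[OF J] L\<close>)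

lemma L_compose:
  assumes "b \<in> A" "a \<in> A"
  shows "L (b o\<^sub>L a) = L b o\<^sub>L a"
  by (rule L_unique) (use assms in \<open>auto simp: orth intro: alg_compose[OF A] right_idealD(5)[OF J] L\<close>)

lemma L_norm:
  assumes b: "b \<in> A"
  shows "norm (L b) \<le> norm b"
proof (rule norm_blinfun_bound)
  fix \<xi>
  have "(norm (L b \<xi>))\<^sup>2 = rinner (b \<xi>) (L b \<xi>)"
    using orth[OF b L[OF b], of \<xi> \<xi>] by (simp add: rinner.diff_left rinner_self)
  also have "\<dots> \<le> norm (b \<xi>) * norm (L b \<xi>)"
    using rinner_Cauchy_Schwarz[of "b \<xi>" "L b \<xi>"] by simp
  finally have "norm (L b \<xi>) \<le> norm (b \<xi>)"
    by (cases "L b \<xi> = 0") (auto simp: power2_eq_square)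
  then show "norm (L b \<xi>) \<le> norm b * norm \<xi>" using norm_blinfun order_trans by blast
qed simp

lemma L_tendsto:
  assumes X: "(X \<longlongrightarrow> l) F" "\<forall>\<^sub>F t in F. X t \<in> A" and l: "l \<in> A"
  shows "((\<lambda>t. L (X t)) \<longlongrightarrow> L l) F"
proof (rule Lim_null[THEN iffD2], rule Lim_null_comparison)
  show "\<forall>\<^sub>F t in F. norm (L (X t) - L l) \<le> norm (X t - l)"
    using X(2) by eventually_elim (use L_norm l in \<open>auto simp: alg_diff[OF A] simp flip: L_diff\<close>)
  show "((\<lambda>t. norm (X t - l)) \<longlongrightarrow> 0) F"
    using X(1) by (intro tendsto_norm_zero Lim_null[THEN iffD1])
qed

text \<open>The limit is a P. With w the adjoint of \<open>a\<close> at \<eta>, self-adjointness of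
  \<open>P\<close> gives <a P c \<xi>, \<eta>> = <c \<xi>, P w>. Since w is near d w for some d in
  \<open>A\<close>, P w is near z = L d w, which \<open>c\<close> almost fixes once \<open>c\<close>
  almost fixes L d. So the form is near <\<xi>, z>, free of \<open>c\<close> and uniformly over unit
  vectors.\<close>

lemma right_multiplication_converges:
  assumes a: "a \<in> A"
  shows "\<exists>r. ((\<lambda>c. a o\<^sub>L L c) \<longlongrightarrow> r) C"
proof -
  define M where "M = norm a + 1"
  have M: "1 \<le> M" "norm a \<le> M" by (auto simp: M_def)
  have "cauchy_filter (filtermap (\<lambda>c. a o\<^sub>L L c) C)"
    unfolding cauchy_filter_metric_filtermap
  proof (intro allI impI)
    fix \<tau> :: real assume \<tau>: "0 < \<tau>"
    \<comment> \<open>Each of \<open>c\<close>, \<open>c'\<close> deviates from <\<xi>, z> by at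
      most 5 s M^2, of which 3 come from removing \<open>c\<close> and 2 from replacing w by d
      w.\<close>
    define s where "s = min 1 (\<tau> / (20 * M\<^sup>2))"
    have s: "0 < s" "s \<le> 1" using \<tau> M by (auto simp: s_def)
    have "s \<le> \<tau> / (20 * M\<^sup>2)" by (simp add: s_def)
    then have sM: "10 * (s * M\<^sup>2) \<le> \<tau> / 2" using M by (simp add: pos_le_divide_eq)
    have "\<forall>\<^sub>F d in C. dist (a o\<^sub>L d) a < s\<^sup>2" using s by (intro tendstoD[OF C_right[OF a]]) simp
    then have "\<forall>\<^sub>F d in C. dist (a o\<^sub>L d) a < s\<^sup>2 \<and> d \<in> A \<and> norm d \<le> 1"
      using C(2) by eventually_elim simp
    then obtain d where d: "dist (a o\<^sub>L d) a < s\<^sup>2" "d \<in> A" "norm d \<le> 1"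
      using eventually_happens'[OF C(1)] by blast
    define P where "P c \<longleftrightarrow> c \<in> A \<and> norm c \<le> 1 \<and> dist (c o\<^sub>L L d) (L d) < s\<^sup>2" for c
    have "\<forall>\<^sub>F c in C. dist (c o\<^sub>L L d) (L d) < s\<^sup>2"
      using s by (intro tendstoD[OF C_left[OF L_alg[OF d(2)]]]) simp
    then have "eventually P C" using C(2) by eventually_elim (simp add: P_def)
    moreover have "dist (a o\<^sub>L L c) (a o\<^sub>L L c') < \<tau>" if cc: "P c" "P c'" for c c'
    proof -
      have "norm ((a o\<^sub>L L c) - (a o\<^sub>L L c')) \<le> \<tau> / 2"
      proof (rule norm_op_le)
        fix \<xi> \<eta> :: 'h assume unit: "norm \<xi> = 1" "norm \<eta> = 1"
        have "bounded_linear (\<lambda>\<xi>. rinner (a \<xi>) \<eta>)"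
          by (intro bounded_linear_compose[OF rinner.bounded_linear_left blinfun.bounded_linear_right])
        then obtain w where w: "\<And>\<xi>. rinner (a \<xi>) \<eta> = rinner \<xi> w"
          using riesz_representation by blast
        have "(norm w)\<^sup>2 = rinner (a w) \<eta>" by (simp add: w rinner_self)
        also have "\<dots> \<le> norm (a w) * norm \<eta>" using rinner_Cauchy_Schwarz[of "a w" \<eta>] by simp
        also have "\<dots> \<le> norm a * norm w" using unit norm_blinfun[of a w] by simp
        finally have "norm w \<le> norm a" by (cases "w = 0") (auto simp: power2_eq_square)
        then have wM: "norm w \<le> M" using M by simp
        \<comment> \<open>A contraction satisfies norm (d w - w) ^ 2 \<le> 2 <w - d w, w>, and the
          right side equals 2 <a w - a (d w), \<eta>>. Thus a d being near a on the right makes d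
          almost fix the adjoint's value.\<close>
        have dw: "norm (d w - w) \<le> 2 * s * M"
        proof (rule power2_le_imp_le)
          have "(norm (d w))\<^sup>2 \<le> (norm w)\<^sup>2" using contraction_apply[OF d(3)] by (intro power_mono) auto
          moreover have "rinner (a (d w)) \<eta> = rinner (d w) w" "rinner (a w) \<eta> = (norm w)\<^sup>2"
            by (simp_all add: w rinner_self)
          ultimately have "(norm (d w - w))\<^sup>2 \<le> 2 * rinner (a w - a (d w)) \<eta>"
            by (simp add: norm_diff_sq rinner.diff_left)
          also have "\<dots> \<le> 2 * (norm (a w - a (d w)) * norm \<eta>)"
            using rinner_Cauchy_Schwarz[of "a w - a (d w)" \<eta>] by simp
          also have "norm (a w - a (d w)) = norm (((a o\<^sub>L d) - a) w)"
            by (simp add: blinfun.diff_left norm_minus_commute)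
          also have "2 * (norm (((a o\<^sub>L d) - a) w) * norm \<eta>) \<le> 2 * (s\<^sup>2 * M)"
            using norm_blinfun[of "(a o\<^sub>L d) - a" w] d(1) wM unit
              mult_mono[of "norm ((a o\<^sub>L d) - a)" "s\<^sup>2" "norm w" M]
            by (simp add: dist_norm)
          also have "\<dots> \<le> 4 * (s\<^sup>2 * M\<^sup>2)"
          proof -
            have "s\<^sup>2 * M \<le> s\<^sup>2 * M\<^sup>2" using M by (intro mult_left_mono) (auto simp: power2_eq_square)
            moreover have "0 \<le> s\<^sup>2 * M\<^sup>2" by simp
            ultimately show ?thesis by linarith
          qed
          also have "\<dots> = (2 * s * M)\<^sup>2" by (simp add: power_mult_distrib)
          finally show "(norm (d w - w))\<^sup>2 \<le> (2 * s * M)\<^sup>2" .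
        qed (use s M in simp)
        define z where "z = L d w"
        have zM: "norm z \<le> M"
          using contraction_apply[of "L d" w] L_norm[OF d(2)] d(3) wM by (simp add: z_def)
        have close: "\<bar>rinner (a (L c \<xi>)) \<eta> - rinner \<xi> z\<bar> \<le> 5 * (s * M\<^sup>2)" if c: "P c" for c
        proof -
          have cA: "c \<in> A" "norm c \<le> 1" using c by (auto simp: P_def)
          have "norm (c z - z) = norm (((c o\<^sub>L L d) - L d) w)" by (simp add: z_def blinfun.diff_left)
          also have "\<dots> \<le> norm ((c o\<^sub>L L d) - L d) * norm w" by (rule norm_blinfun)
          also have "\<dots> \<le> s\<^sup>2 * M" using c wM by (intro mult_mono) (auto simp: P_def dist_norm)
          finally have 1: "\<bar>rinner (c \<xi> - \<xi>) z\<bar> \<le> 3 * s * M\<^sup>2"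
            using unit M by (intro contraction_almost_fixing[OF cA(2) _ zM _ s]) auto
          have "norm (L c \<xi>) \<le> 1"
            using contraction_apply[of "L c" \<xi>] L_norm[OF cA(1)] cA(2) unit by simp
          then have "norm (L c \<xi>) * norm (d w - w) \<le> 1 * (2 * s * M)"
            using dw by (intro mult_mono) auto
          then have "\<bar>rinner (L c \<xi>) (d w - w)\<bar> \<le> 2 * s * M"
            using rinner_Cauchy_Schwarz[of "L c \<xi>" "d w - w"] by simp
          moreover have "s * M \<le> s * M\<^sup>2"
            using s M by (intro mult_left_mono) (auto simp: power2_eq_square)
          ultimately have 2: "\<bar>rinner (L c \<xi>) (d w - w)\<bar> \<le> 2 * (s * M\<^sup>2)" by linarith
          \<comment> \<open>Self-adjointness of \<open>P\<close>, obtained from \<open>orth\<close>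
            twice: both d w - L d w and c \<xi> - L c \<xi> are orthogonal to the ranges of
            \<open>J\<close>.\<close>
          have "rinner (L c \<xi>) (d w) = rinner (L c \<xi>) z"
            using orth[OF d(2) L[OF cA(1)], of w \<xi>] rinner_commute[of "L c \<xi>"]
            by (simp add: rinner.diff_left z_def)
          moreover have "rinner (L c \<xi>) z = rinner (c \<xi>) z"
            using orth[OF cA(1) L[OF d(2)], of \<xi> w] by (simp add: rinner.diff_left z_def)
          ultimately have "rinner (a (L c \<xi>)) \<eta> - rinner \<xi> z =
              rinner (c \<xi> - \<xi>) z - rinner (L c \<xi>) (d w - w)"
            by (simp add: w rinner.diff_left rinner.diff_right)
          then show ?thesis using 1 2 by linarith
        qed
        show "rinner (((a o\<^sub>L L c) - (a o\<^sub>L L c')) \<xi>) \<eta> \<le> \<tau> / 2"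
          using close[OF cc(1)] close[OF cc(2)] sM
          by (simp add: blinfun.diff_left rinner.diff_left)
      qed (use \<tau> in simp)
      then show ?thesis using \<tau> by (simp add: dist_norm)
    qed
    ultimately show "\<exists>P. eventually P C \<and> (\<forall>c c'. P c \<and> P c' \<longrightarrow> dist (a o\<^sub>L L c) (a o\<^sub>L L c') < \<tau>)"
      by blast
  qed
  then have "\<exists>r. filtermap (\<lambda>c. a o\<^sub>L L c) C \<le> nhds r"
    using C(1) by (intro cauchy_filter_complete_converges[of _ UNIV]) (auto simp: complete_UNIV filtermap_bot_iff)
  then show ?thesis by (simp add: filterlim_def)
qed

text \<open>\<open>L\<close> and \<open>R\<close> form a double centralizer, (R a) b = a (L b), both
  idempotent and contractive. It remains to realize the pair by one element of the bidual, for which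
  e b = L b and a e = R a.\<close>

lemma support_projection:
  "\<exists>e\<in>multiplier_algebra A. bidual_projection A e \<and>
     canon A ` J = (\<lambda>a. arens A e (canon A a)) ` A"
proof -
  obtain R where R: "\<And>a. a \<in> A \<Longrightarrow> ((\<lambda>c. a o\<^sub>L L c) \<longlongrightarrow> R a) C"
    using right_multiplication_converges by metis
  have CA: "\<forall>\<^sub>F c in C. c \<in> A" using C(2) by (auto elim: eventually_mono)
  have R_alg: "R a \<in> A" if a: "a \<in> A" for a
    by (rule Lim_in_closed_set[OF alg_closed[OF A] _ C(1) R[OF a]])
      (use CA a in \<open>auto elim!: eventually_mono intro: alg_compose[OF A] L_alg\<close>)
  have R_compose_right: "R a o\<^sub>L b = a o\<^sub>L L b" if a: "a \<in> A" and b: "b \<in> A" for a b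
  proof (rule tendsto_unique[OF C(1)])
    show "((\<lambda>c. (a o\<^sub>L L c) o\<^sub>L b) \<longlongrightarrow> R a o\<^sub>L b) C" by (intro compose_tendsto R a tendsto_const)
    have "\<forall>\<^sub>F c in C. c o\<^sub>L b \<in> A" using CA by eventually_elim (simp add: alg_compose[OF A] b)
    then have "((\<lambda>c. a o\<^sub>L L (c o\<^sub>L b)) \<longlongrightarrow> a o\<^sub>L L b) C"
      by (intro compose_tendsto tendsto_const L_tendsto C_left b)
    moreover have "\<forall>\<^sub>F c in C. a o\<^sub>L L (c o\<^sub>L b) = (a o\<^sub>L L c) o\<^sub>L b"
      using CA by eventually_elim (simp add: L_compose b compose_assoc)
    ultimately show "((\<lambda>c. (a o\<^sub>L L c) o\<^sub>L b) \<longlongrightarrow> a o\<^sub>L L b) C"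
      using Lim_transform_eventually by fast
  qed
  have R_compose: "R (x o\<^sub>L a) = x o\<^sub>L R a" if x: "x \<in> A" and a: "a \<in> A" for x a
  proof (rule tendsto_unique[OF C(1) R[OF alg_compose[OF A x a]]])
    show "((\<lambda>c. (x o\<^sub>L a) o\<^sub>L L c) \<longlongrightarrow> x o\<^sub>L R a) C"
      using compose_tendsto[OF tendsto_const R[OF a]] by (simp add: compose_assoc)
  qed
  have R_idem: "R (R a) = R a" if a: "a \<in> A" for a
  proof (rule tendsto_unique[OF C(1) _ R[OF a]])
    have "\<forall>\<^sub>F c in C. R a o\<^sub>L L c = a o\<^sub>L L c"
      using CA by eventually_elim (simp add: R_compose_right a L_alg L_fix L)
    then show "((\<lambda>c. a o\<^sub>L L c) \<longlongrightarrow> R (R a)) C"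
      using R[OF R_alg[OF a]] Lim_transform_eventually by fast
  qed
  have L_contr: "\<forall>\<^sub>F c in C. norm (L c) \<le> 1"
    using C(2) by eventually_elim (use L_norm order_trans in blast)
  have R_norm: "norm (R a) \<le> norm a" if a: "a \<in> A" for a
  proof (rule tendsto_upperbound[OF tendsto_norm[OF R[OF a]] _ C(1)])
    show "\<forall>\<^sub>F c in C. norm (a o\<^sub>L L c) \<le> norm a"
      using L_contr by eventually_elim (rule norm_compose_le_right)
  qed
  have R_diff: "R (a - b) = R a - R b" if "a \<in> A" "b \<in> A" for a b
  proof (rule tendsto_unique[OF C(1) R[OF alg_diff[OF A that]]])
    show "((\<lambda>c. (a - b) o\<^sub>L L c) \<longlongrightarrow> R a - R b) C"
      unfolding compose_diff_left by (intro tendsto_diff R that)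
  qed
  have R_tendsto: "((\<lambda>t. R (X t)) \<longlongrightarrow> R l) F"
    if X: "(X \<longlongrightarrow> l) F" "\<forall>\<^sub>F t in F. X t \<in> A" and l: "l \<in> A" for X :: "('h \<Rightarrow>\<^sub>L 'h) \<Rightarrow> _" and l F
  proof (rule Lim_null[THEN iffD2], rule Lim_null_comparison)
    show "\<forall>\<^sub>F t in F. norm (R (X t) - R l) \<le> norm (X t - l)"
      using X(2) by eventually_elim (use R_norm l in \<open>auto simp: alg_diff[OF A] simp flip: R_diff\<close>)
    show "((\<lambda>t. norm (X t - l)) \<longlongrightarrow> 0) F"
      using X(1) by (intro tendsto_norm_zero Lim_null[THEN iffD1])
  qed
  \<comment> \<open>The two-sided compression, rather than \<open>L c\<close> alone, makes
    \<open>R\<close> fix every \<open>Q c\<close>, and idempotence of the limit is then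
    immediate.\<close>
  define Q where "Q c = R (L c)" for c
  have "\<forall>\<^sub>F c in C. Q c \<in> A \<and> norm (Q c) \<le> 1"
    using C(2)
  proof eventually_elim
    case (elim c)
    then show ?case using R_alg[OF L_alg] R_norm[OF L_alg] L_norm[of c] by (force simp: Q_def)
  qed
  then obtain e G where e: "e \<in> bidual A" "bidual_norm A e \<le> 1" and G: "G \<le> C" "G \<noteq> bot"
    and lim: "\<And>f. f \<in> dual A \<Longrightarrow> ((\<lambda>c. f (Q c)) \<longlongrightarrow> e f) G"
    using weak_star_cluster_point[OF A C(1), of Q] by blast
  have GA: "\<forall>\<^sub>F c in G. c \<in> A" using filter_leD[OF G(1) CA] .
  have e_right: "arens A e (canon A b) = canon A (L b)" if b: "b \<in> A" for b
  proof (rule ext)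
    fix f
    show "arens A e (canon A b) f = canon A (L b) f"
    proof (cases "f \<in> dual A")
      case f: True
      let ?g = "\<lambda>x. if x \<in> A then f (x o\<^sub>L b) else 0"
      have "e ?g = f (L b)"
      proof (rule tendsto_unique[OF G(2) lim])
        show "?g \<in> dual A" by (rule dual_translate(2)[OF A f b b])
        have "((\<lambda>c. L (c o\<^sub>L L b)) \<longlongrightarrow> L (L b)) C"
          using CA by (intro L_tendsto C_left L_alg b)
            (auto elim!: eventually_mono intro: alg_compose[OF A] L_alg b)
        then have "((\<lambda>c. L (c o\<^sub>L L b)) \<longlongrightarrow> L b) G"
          using tendsto_mono[OF G(1)] L_fix[OF L[OF b]] by simp
        then have "((\<lambda>c. f (L (c o\<^sub>L L b))) \<longlongrightarrow> f (L b)) G"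
          by (rule dual_tendsto[OF A f])
            (use GA b in \<open>auto elim!: eventually_mono intro: alg_compose[OF A] L_alg\<close>)
        \<comment> \<open>Here R (L c) b = L c (L b) = L (c (L b)), so that the left approximate
          identity acts on L b.\<close>
        moreover have "\<forall>\<^sub>F c in G. f (L (c o\<^sub>L L b)) = ?g (Q c)"
          using GA
        proof eventually_elim
          case (elim c)
          then show ?case by (simp add: Q_def R_alg L_alg R_compose_right b L_compose)
        qed
        ultimately show "((\<lambda>c. ?g (Q c)) \<longlongrightarrow> f (L b)) G"
          using Lim_transform_eventually by fast
      qed
      then show ?thesis unfolding arens_canon_right[OF A b f] using f by (simp add: canon_def)
    qed (simp add: arens_def canon_def)
  qed
  have e_left: "arens A (canon A a) e = canon A (R a)" if a: "a \<in> A" for a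
  proof (rule ext)
    fix f
    show "arens A (canon A a) e f = canon A (R a) f"
    proof (cases "f \<in> dual A")
      case f: True
      have "e (dual_act_alg A f a) = f (R a)"
      proof (rule tendsto_unique[OF G(2) lim])
        show "dual_act_alg A f a \<in> dual A" by (rule dual_translate(3)[OF A f a a])
        have "((\<lambda>c. R (a o\<^sub>L L c)) \<longlongrightarrow> R (R a)) C"
          using CA by (intro R_tendsto R R_alg a)
            (auto elim!: eventually_mono intro: alg_compose[OF A] L_alg a)
        then have "((\<lambda>c. R (a o\<^sub>L L c)) \<longlongrightarrow> R a) G"
          using tendsto_mono[OF G(1)] R_idem[OF a] by simp
        then have "((\<lambda>c. f (R (a o\<^sub>L L c))) \<longlongrightarrow> f (R a)) G"
          by (rule dual_tendsto[OF A f])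
            (use GA a in \<open>auto elim!: eventually_mono intro: alg_compose[OF A] L_alg R_alg\<close>)
        moreover have "\<forall>\<^sub>F c in G. f (R (a o\<^sub>L L c)) = dual_act_alg A f a (Q c)"
          using GA by eventually_elim (simp add: Q_def R_compose a L_alg R_alg dual_act_alg_def)
        ultimately show "((\<lambda>c. dual_act_alg A f a (Q c)) \<longlongrightarrow> f (R a)) G"
          using Lim_transform_eventually by fast
      qed
      then show ?thesis unfolding arens_canon_left[OF A a e(1) f] using f by (simp add: canon_def)
    qed (simp add: arens_def canon_def)
  qed
  have idem: "arens A e e = e"
  proof (rule ext)
    fix f
    show "arens A e e f = e f"
    proof (cases "f \<in> dual A")
      case f: True
      let ?g = "bidual_act_dual A e f"
      \<comment> \<open>On \<open>A\<close> the functional e \<cdot> f is f after \<open>R\<close>,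
        which agrees with f on the elements \<open>Q c\<close>.\<close>
      have g: "?g a = f (R a)" if "a \<in> A" for a
        using arens_canon_left[OF A that e(1) f] e_left[OF that] that f
        by (simp add: bidual_act_dual_def canon_def)
      have "e ?g = e f"
      proof (rule tendsto_unique[OF G(2) lim lim[OF f, THEN Lim_transform_eventually]])
        show "?g \<in> dual A" by (rule bidual_act_in_dual[OF A e(1) f])
        show "\<forall>\<^sub>F c in G. f (Q c) = ?g (Q c)"
          using GA by eventually_elim (simp add: Q_def g R_alg L_alg R_idem)
      qed
      then show ?thesis using f by (simp add: arens_def)
    next
      case False
      then show ?thesis using e(1) by (simp add: arens_def bidual_def cdual_def)
    qed
  qed
  show ?thesis
  proof (intro bexI conjI)
    show "e \<in> multiplier_algebra A"
      using e(1) by (auto simp: multiplier_algebra_def e_left e_right L_alg R_alg)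
    show "bidual_projection A e" using e idem by (simp add: bidual_projection_def)
    have "L ` A = J" using L L_fix J_subset by (force simp: image_def)
    then have "canon A ` J = (\<lambda>a. canon A (L a)) ` A" by (metis image_image)
    then show "canon A ` J = (\<lambda>a. arens A e (canon A a)) ` A" by (simp add: e_right)
  qed
qed

end

theorem theorem5p8:
  fixes A :: "('h::complex_hilbert \<Rightarrow>\<^sub>L 'h) set"
  assumes "operator_algebra A"
    and "hereditary_in_bidual A"
  shows "nc_discrete A"
proof -
  have cai: "has_cai A" using assms(2) by (simp add: hereditary_in_bidual_def)
  then obtain C where C: "C \<noteq> bot" "\<forall>\<^sub>F c in C. c \<in> A \<and> norm c \<le> 1"
    "\<And>x. x \<in> A \<Longrightarrow> ((\<lambda>c. c o\<^sub>L x) \<longlongrightarrow> x) C" "\<And>x. x \<in> A \<Longrightarrow> ((\<lambda>c. x o\<^sub>L c) \<longlongrightarrow> x) C"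
    unfolding has_cai_def by blast
  have "\<exists>e\<in>multiplier_algebra A. bidual_projection A e \<and>
      canon A ` J = (\<lambda>a. arens A e (canon A a)) ` A"
    if J: "right_ideal A J" "has_left_cai J" for J
  proof -
    obtain L where L: "\<And>b. b \<in> A \<Longrightarrow> L b \<in> J"
      and orth: "\<And>b j \<xi> \<eta>. b \<in> A \<Longrightarrow> j \<in> J \<Longrightarrow> rinner (b \<xi> - L b \<xi>) (j \<eta>) = 0"
      using orthogonal_decomposition[OF assms J] by metis
    show ?thesis by (rule support_projection[of A J C L]) (fact assms(1) J(1) C L orth)+
  qed
  with assms(1) cai show ?thesis by (simp add: nc_discrete_def)
qed

end
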